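(* Let $F:\mathbb{R}^n\rightrightarrows\mathbb{R}^n$ be upper semicontinuous with nonempty compact values. Let $f:\mathbb{R}^n\to\mathbb{R}$ be a (locally Lipschitz) potential of a conservative field $D:\mathbb{R}^n\rightrightarrows\mathbb{R}^n$ such that for every $\widehat{x}\in\mathbb{R}^n$ there exist $\rho\in(0,\infty)$ and $\kappa\in\mathcal{P}$ with $$\forall x\in B_\rho(\widehat{x}),\quad \max_{u\in\mathrm{co}\,F(x)}\ \min_{v\in D(x)}\langle u,v\rangle\leq-\min_{w\in D(x)}\kappa(w),$$ and such that, for some $\overline{\ell}>0$, no $x\in\mathbb{R}^n$ satisfies both $0\in D(x)$ and $f(x)\in(0,\overline{\ell})$. Assume $\min f=0$. Let $p\in[1,\infty)$ and suppose: (i) $g:\mathbb{R}^n\to\mathbb{R}$ is continuous with $\min g=0$; (ii) $g$ is $p$-d-Lyapunov (for $F$) near every point in $\arg\min f\cap\{x:g(x)>0\}$, i.e., every such point has a neighborhood on which $g$ is $p$-d-Lyapunov; (iii) $f+g$ is coercive. Then $\arg\min(f+g)$ is an asymptotic $p$-attractor (with respect to $F$ and $f$).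
   Context: $|\cdot|=\sqrt{\langle\cdot,\cdot\rangle}$ is the Euclidean norm, $d(x,X)=\inf\{|x-y|:y\in X\}$, $B_r(X)=\{x:d(x,X)<r\}$ for a set $X$, $B_r(\widehat{x})$ is the open ball, $[f=0]=\{x:f(x)=0\}$, $\mathrm{co}$ is the convex hull, $\mathbb{N}=\{0,1,2,\dots\}$. Coercive means tending to $\infty$ as $|x|\to\infty$. $F$ is upper semicontinuous if for every $x$ and every neighborhood $V$ of $F(x)$ there is a neighborhood $U$ of $x$ with $F(U)=\bigcup_{y\in U}F(y)\subseteq V$. $\mathcal{P}$ is the set of continuous functions $\kappa:\mathbb{R}^n\to\mathbb{R}$ with $\kappa(0)=0$ and $\kappa(x)>0$ for all $x\neq0$. Conservative field: given a locally Lipschitz function $f:\mathbb{R}^n\to\mathbb{R}$, a set-valued map $D:\mathbb{R}^n\rightrightarrows\mathbb{R}^n$ is a conservative field for $f$ (and $f$ is called a potential of $D$) if $D$ has a closed graph, nonempty compact values, and for every absolutely continuous curve $x:[0,1]\to\mathbb{R}^n$, for almost every $t\in(0,1)$ and for all $v\in D(x(t))$, $(f\circ x)'(t)=\langle v,x'(t)\rangle$. An Euler sequence of $F$ with step sizes $\{\alpha_k\}_{k\in\mathbb{N}}\subseteq(0,\infty)$ is a sequence $\{x_k\}_{k\in\mathbb{N}}\subseteq\mathbb{R}^n$ with $x_{k+1}\in x_k+\alpha_kF(x_k)$ for all $k\in\mathbb{N}$. $p$-d-Lyapunov: $g$ is $p$-d-Lyapunov on $U\subseteq\mathbb{R}^n$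 if there exist $\overline{\alpha},\omega>0$ such that for all $\alpha\in(0,\overline{\alpha}]$, $x\in U$, $u\in F(x)$: $g(x+\alpha u)-g(x)\leq-\omega\alpha^p$. d-stable set: $X\subseteq\mathbb{R}^n$ is d-stable if for every $\epsilon>0$ there exist $\delta,\overline{\alpha}>0$ such that for all $\{\alpha_k\}_{k\in\mathbb{N}}\subseteq(0,\overline{\alpha}]$ and all Euler sequences $\{x_k\}$ with these step sizes: $x_0\in B_\delta(X)\Rightarrow\{x_k\}_{k\in\mathbb{N}}\subseteq B_\epsilon(X)$. Asymptotically $p$-d-stable set: $X$ is asymptotically $p$-d-stable if it is d-stable and there exist $\delta_0,\overline{\alpha}_0>0$ such that for all $\{\alpha_k\}_{k\in\mathbb{N}}\subseteq(0,\overline{\alpha}_0]$ with $\sum_{k=0}^\infty\alpha_k^p=\infty$ and $\alpha_k\to0$, and all Euler sequences $\{x_k\}$ with these step sizes: $x_0\in B_{\delta_0}(X)\Rightarrow d(x_k,X)\to0$. $p$-attractor: given $F$ and a nonnegative $f$, a bounded set $A\subseteq[f=0]$ is a $p$-attractor if for all $\epsilon,\ell>0$ and every bounded set $X\subseteq[f=0]$ there exist $\delta,\overline{\alpha}>0$ such that for all $\{\alpha_k\}_{k\in\mathbb{N}}\subseteq(0,\overline{\alpha}]$ with $\sum_{k=0}^\infty\alpha_k^p=\infty$ and all Euler sequences $\{x_k\}$ with these step sizes and $x_0\in B_\delta(X)$: $f(x_k)\leq\ell$ for all $k\in\mathbb{N}$, and there exists $k_0\in\mathbb{N}$ with $\{x_k\}_{k\geq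 k_0}\subseteq B_\epsilon(A)$. It is an asymptotic $p$-attractor if in addition it is asymptotically $p$-d-stable. *)

theory Defs
  imports "HOL-Analysis.Analysis"
begin

section \<open>Functions and set-valued maps\<close>

definition locally_lipschitz :: "('a::metric_space \<Rightarrow> 'b::metric_space) \<Rightarrow> bool" where
  "locally_lipschitz f \<longleftrightarrow> (\<forall>x. \<exists>r>0. \<exists>L. L-lipschitz_on (ball x r) f)"

definition upper_semicontinuous ::
    "('a::topological_space \<Rightarrow> 'b::topological_space set) \<Rightarrow> bool" where
  "upper_semicontinuous F \<longleftrightarrow>
    (\<forall>x V. open V \<and> F x \<subseteq> V \<longrightarrow> (\<exists>U. open U \<and> x \<in> U \<and> (\<Union>y\<in>U. F y) \<subseteq> V))"

definition coercive :: "('a::real_normed_vector \<Rightarrow> real) \<Rightarrow> bool" where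
  "coercive h \<longleftrightarrow> filterlim h at_top at_infinity"

definition arg_min_set :: "('a \<Rightarrow> real) \<Rightarrow> 'a set" where
  "arg_min_set h = {x. is_arg_min h (\<lambda>_. True) x}"

text \<open>The minimum of \<open>h\<close> is required to be attained.\<close>

definition has_minimum :: "('a \<Rightarrow> real) \<Rightarrow> real \<Rightarrow> bool" where
  "has_minimum h m \<longleftrightarrow> (\<exists>x\<in>arg_min_set h. h x = m)"

text \<open>The class \<open>\<P>\<close> of continuous positive definite functions.\<close>

definition pos_def_functions :: "('a::real_normed_vector \<Rightarrow> real) set" where
  "pos_def_functions =
    {\<kappa>. continuous_on UNIV \<kappa> \<and> \<kappa> 0 = 0 \<and> (\<forall>x. x \<noteq> 0 \<longrightarrow> \<kappa> x > 0)}"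

section \<open>Conservative fields\<close>

text \<open>Absolute continuity of curves in the epsilon-delta sense; the constant
  \<open>absolutely_continuous\<close> of HOL-Analysis is a relation between measures.\<close>

definition absolutely_continuous_curve ::
    "real \<Rightarrow> real \<Rightarrow> (real \<Rightarrow> 'a::real_normed_vector) \<Rightarrow> bool" where
  "absolutely_continuous_curve c d \<gamma> \<longleftrightarrow>
    (\<forall>\<epsilon>>0. \<exists>\<delta>>0. \<forall>(m::nat) a b.
      (\<forall>i<m. c \<le> a i \<and> a i \<le> b i \<and> b i \<le> d) \<and>
      disjoint_family_on (\<lambda>i. {a i<..<b i}) {..<m} \<and>
      (\<Sum>i<m. b i - a i) < \<delta>
      \<longrightarrow> (\<Sum>i<m. norm (\<gamma> (b i) - \<gamma> (a i))) < \<epsilon>)"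

text \<open>The equation \<open>(f \<circ> \<gamma>)'(t) = \<langle>v, \<gamma>'(t)\<rangle>\<close> is read as including the existence of both
  derivatives. At almost every \<open>t\<close> this is automatic, since \<open>\<gamma>\<close> and \<open>f \<circ> \<gamma>\<close> are absolutely
  continuous on the unit interval.\<close>

definition conservative_field ::
    "('a::euclidean_space \<Rightarrow> real) \<Rightarrow> ('a \<Rightarrow> 'a set) \<Rightarrow> bool" where
  "conservative_field f D \<longleftrightarrow>
    locally_lipschitz f \<and>
    closed {(x, v). v \<in> D x} \<and>
    (\<forall>x. D x \<noteq> {} \<and> compact (D x)) \<and>
    (\<forall>\<gamma>. absolutely_continuous_curve 0 1 \<gamma> \<longrightarrow>
      (AE t in lebesgue. t \<in> {0<..<1} \<longrightarrow>
        (\<exists>\<gamma>'. (\<gamma> has_vector_derivative \<gamma>') (at t) \<and>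
          (\<forall>v\<in>D (\<gamma> t). ((f \<circ> \<gamma>) has_real_derivative (v \<bullet> \<gamma>')) (at t)))))"

section \<open>Euler sequences and discrete stability\<close>

text \<open>The open tube \<open>{x. d(x, X) < r}\<close>. It is empty for empty \<open>X\<close>, in accordance with
  \<open>d(x, {}) = \<infinity>\<close>; the case has to be excluded explicitly because \<open>infdist x {} = 0\<close>.\<close>

definition tube :: "real \<Rightarrow> 'a::metric_space set \<Rightarrow> 'a set" where
  "tube r X = {x. X \<noteq> {} \<and> infdist x X < r}"

definition euler_sequence ::
    "('a::real_normed_vector \<Rightarrow> 'a set) \<Rightarrow> (nat \<Rightarrow> real) \<Rightarrow> (nat \<Rightarrow> 'a) \<Rightarrow> bool" where
  "euler_sequence F \<alpha> x \<longleftrightarrow>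
    (\<forall>k. \<alpha> k > 0) \<and> (\<forall>k. x (Suc k) \<in> (\<lambda>u. x k + \<alpha> k *\<^sub>R u) ` F (x k))"

definition p_d_Lyapunov ::
    "('a::real_normed_vector \<Rightarrow> 'a set) \<Rightarrow> real \<Rightarrow> ('a \<Rightarrow> real) \<Rightarrow> 'a set \<Rightarrow> bool" where
  "p_d_Lyapunov F p g U \<longleftrightarrow>
    (\<exists>\<alpha>bar>0. \<exists>\<omega>>0. \<forall>\<alpha>\<in>{0<..\<alpha>bar}. \<forall>x\<in>U. \<forall>u\<in>F x.
      g (x + \<alpha> *\<^sub>R u) - g x \<le> - \<omega> * \<alpha> powr p)"

definition d_stable :: "('a::real_normed_vector \<Rightarrow> 'a set) \<Rightarrow> 'a set \<Rightarrow> bool" where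
  "d_stable F X \<longleftrightarrow>
    (\<forall>\<epsilon>>0. \<exists>\<delta>>0. \<exists>\<alpha>bar>0. \<forall>\<alpha> x.
      range \<alpha> \<subseteq> {0<..\<alpha>bar} \<and> euler_sequence F \<alpha> x \<and> x 0 \<in> tube \<delta> X
      \<longrightarrow> range x \<subseteq> tube \<epsilon> X)"

text \<open>The series of \<open>p\<close>-th powers of the step sizes is summed in the extended nonnegative
  reals, so that \<open>\<Sum>k \<alpha>\<^sub>k\<^sup>p = \<infinity>\<close> can be stated literally.\<close>

definition p_divergent :: "real \<Rightarrow> (nat \<Rightarrow> real) \<Rightarrow> bool" where
  "p_divergent p \<alpha> \<longleftrightarrow> (\<Sum>k. ennreal (\<alpha> k powr p)) = \<infinity>"

definition asymptotically_p_d_stable ::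
    "('a::real_normed_vector \<Rightarrow> 'a set) \<Rightarrow> real \<Rightarrow> 'a set \<Rightarrow> bool" where
  "asymptotically_p_d_stable F p X \<longleftrightarrow>
    d_stable F X \<and>
    (\<exists>\<delta>\<^sub>0>0. \<exists>\<alpha>bar\<^sub>0>0. \<forall>\<alpha> x.
      range \<alpha> \<subseteq> {0<..\<alpha>bar\<^sub>0} \<and> p_divergent p \<alpha> \<and> \<alpha> \<longlonglongrightarrow> 0 \<and>
      euler_sequence F \<alpha> x \<and> x 0 \<in> tube \<delta>\<^sub>0 X
      \<longrightarrow> (\<lambda>k. infdist (x k) X) \<longlonglongrightarrow> 0)"

definition p_attractor ::
    "('a::real_normed_vector \<Rightarrow> 'a set) \<Rightarrow> ('a \<Rightarrow> real) \<Rightarrow> real \<Rightarrow> 'a set \<Rightarrow> bool" where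
  "p_attractor F f p A \<longleftrightarrow>
    bounded A \<and> A \<subseteq> {x. f x = 0} \<and>
    (\<forall>\<epsilon>>0. \<forall>l>0. \<forall>X. bounded X \<and> X \<subseteq> {x. f x = 0} \<longrightarrow>
      (\<exists>\<delta>>0. \<exists>\<alpha>bar>0. \<forall>\<alpha> x.
        range \<alpha> \<subseteq> {0<..\<alpha>bar} \<and> p_divergent p \<alpha> \<and>
        euler_sequence F \<alpha> x \<and> x 0 \<in> tube \<delta> X
        \<longrightarrow> (\<forall>k. f (x k) \<le> l) \<and> (\<exists>k\<^sub>0. \<forall>k\<ge>k\<^sub>0. x k \<in> tube \<epsilon> A)))"

definition asymptotic_p_attractor ::
    "('a::real_normed_vector \<Rightarrow> 'a set) \<Rightarrow> ('a \<Rightarrow> real) \<Rightarrow> real \<Rightarrow> 'a set \<Rightarrow> bool" where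
  "asymptotic_p_attractor F f p A \<longleftrightarrow>
    p_attractor F f p A \<and> asymptotically_p_d_stable F p A"

end

theory Submission
  imports Defs "HOL-Complex_Analysis.Great_Picard"
begin

text \<open>The descent condition controls derivatives along curves; a single Euler step may well
  increase \<open>f\<close>. Hence \<open>f\<close> is compared only over windows of fixed length in
  time, up to an overshoot of one step, and every barrier has a slack factor of two: a start below
  \<open>l / 2\<close> guarantees \<open>l\<close>, and a level \<open>\<eta>\<close> of
  \<open>g\<close> guarantees \<open>2 * \<eta>\<close>.

  The controls of \<open>f\<close> and \<open>g\<close> depend on each other: bounding
  \<open>f\<close> needs a compact set, this needs a bound on \<open>g\<close>, and the Lyapunov
  property needs \<open>f\<close> small. They are therefore carried through one common induction.
  The constants are chosen in the order target, \<open>\<eta>\<close>, \<open>l\<close>, step bound.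
  As the step bound depends on \<open>l\<close>, fixed steps only keep \<open>f\<close> below one
  prescribed level; reaching all levels in turn uses steps tending to zero.

  Two clocks run: \<open>f\<close> is driven by the sum of the steps, \<open>g\<close> by the sum of
  their \<open>p\<close>-th powers. For steps at most 1 and \<open>p \<ge> 1\<close>, divergence of
  the second forces divergence of the first.\<close>

text \<open>Euler polygons with vanishing step sizes converge, by Arzela--Ascoli, to curves whose velocity lies
  in \<open>co F\<close>; the descent condition and the chain rule of the conservative field make \<open>f\<close> strictly
  decrease along such a curve while it avoids critical points. By compactness, Euler sequences with
  small steps therefore decrease \<open>f\<close> by a fixed amount over every time window spent in a compact
  set of noncritical points. Hence \<open>f\<close> stays small once it is small, and tends to zero when the
  steps do. While \<open>f\<close> is small, the Lyapunov property drives \<open>g\<close> below any positive level, since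
  \<open>\<Sum>k \<alpha>\<^sub>k\<^sup>p\<close> diverges, and coercivity keeps the sequence bounded. The same
  argument with constant steps shows that \<open>f\<close> and \<open>g\<close> have a common zero, so that
  \<open>arg min (f + g) = [f = 0] \<inter> [g = 0]\<close>.\<close>

section \<open>Functions with almost everywhere negative derivative\<close>

text \<open>A locally Lipschitz \<open>\<phi>\<close> maps the exceptional null set to a null set, so if \<open>\<phi>\<close> increased
  between two points, some intermediate value would be attained only at points of differentiability;
  at the last such point the derivative would be nonnegative.\<close>

lemma strict_decrease_if_ae_negative_derivative:
  fixes \<phi> :: "real \<Rightarrow> real"
  assumes "a < b" and cont: "continuous_on {a..b} \<phi>" and "negligible N"
    and lip: "\<And>t. t \<in> {a<..<b} \<Longrightarrow>
      \<exists>T B. open T \<and> t \<in> T \<and> (\<forall>s\<in>T \<inter> {a<..<b}. \<bar>\<phi> s - \<phi> t\<bar> \<le> B * \<bar>s - t\<bar>)"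
    and der: "\<And>t. t \<in> {a<..<b} - N \<Longrightarrow> \<exists>d<0. (\<phi> has_real_derivative d) (at t)"
  shows "\<phi> b < \<phi> a"
proof -
  have "negligible (\<phi> ` (N \<inter> {a<..<b}))"
  proof (rule negligible_locally_Lipschitz_image)
    show "negligible (N \<inter> {a<..<b})"
      using \<open>negligible N\<close> by (rule negligible_subset) auto
    fix t assume t: "t \<in> N \<inter> {a<..<b}"
    with lip obtain T B where "open T" "t \<in> T" "\<And>s. s\<in>T \<inter> {a<..<b} \<Longrightarrow> \<bar>\<phi> s - \<phi> t\<bar> \<le> B * \<bar>s - t\<bar>"
      by (metis IntD2)
    then show "\<exists>T B. open T \<and> t \<in> T \<and> (\<forall>y\<in>N \<inter> {a<..<b} \<inter> T. norm (\<phi> y - \<phi> t) \<le> B * norm (y - t))"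
      by (intro exI[of _ T] exI[of _ B]) auto
  qed simp
  have mono: "\<phi> d \<le> \<phi> c" if cd: "a \<le> c" "c \<le> d" "d \<le> b" for c d
  proof (rule ccontr)
    assume "\<not> \<phi> d \<le> \<phi> c"
    then have "\<not> negligible {\<phi> c<..<\<phi> d}"
      by (intro open_not_negligible) auto
    then have "\<not> {\<phi> c<..<\<phi> d} \<subseteq> \<phi> ` (N \<inter> {a<..<b})"
      using \<open>negligible (\<phi> ` _)\<close> negligible_subset by blast
    then obtain y where y: "\<phi> c < y" "y < \<phi> d" "y \<notin> \<phi> ` (N \<inter> {a<..<b})"
      by (meson greaterThanLessThan_iff subsetI)
    have contcd: "continuous_on {c..d} \<phi>"
      using cont by (rule continuous_on_subset) (use cd in auto)
    define Z where "Z = {s\<in>{c..d}. \<phi> s \<le> y}"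
    have "closed ({c..d} \<inter> \<phi> -` {..y})"
      using contcd by (intro continuous_closed_preimage) auto
    moreover have "Z = {c..d} \<inter> \<phi> -` {..y}" by (auto simp: Z_def)
    moreover have "bounded Z" by (rule bounded_subset[of "{c..d}"]) (auto simp: Z_def)
    ultimately have "compact Z" by (simp add: compact_eq_bounded_closed)
    moreover have "c \<in> Z" using y cd by (auto simp: Z_def)
    ultimately obtain t where t: "t \<in> Z" and t_max: "\<And>s. s \<in> Z \<Longrightarrow> s \<le> t"
      using compact_attains_sup[of Z] by auto
    have td: "t < d" using t y by (auto simp: Z_def less_le)
    have "\<phi> t = y"
    proof (rule ccontr)
      assume "\<phi> t \<noteq> y"
      with t have less: "\<phi> t < y" by (simp add: Z_def)
      have "continuous_on {t..d} \<phi>"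
        using contcd by (rule continuous_on_subset) (use t in \<open>auto simp: Z_def\<close>)
      then obtain s where "t \<le> s" "s \<le> d" "\<phi> s = y"
        using IVT'[of \<phi> t y d] less y td by auto
      moreover then have "s \<in> Z" using t by (auto simp: Z_def)
      ultimately show False using t_max[of s] less by auto
    qed
    with t y td cd have "t \<in> {a<..<b}" by (auto simp: Z_def less_le)
    moreover with \<open>\<phi> t = y\<close> y(3) have "t \<notin> N" by blast
    ultimately have "t \<in> {a<..<b} - N" by simp
    with der obtain d' where "d' < 0" "(\<phi> has_real_derivative d') (at t)" by blast
    then obtain e where e: "e > 0" "\<And>h. h > 0 \<Longrightarrow> h < e \<Longrightarrow> \<phi> (t + h) < \<phi> t"
      using DERIV_neg_dec_right by blast
    define h where "h = min (e / 2) (d - t)"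
    have "h > 0" "h < e" using e td by (auto simp: h_def)
    moreover then have "t + h \<in> Z"
      using e(2)[of h] \<open>\<phi> t = y\<close> t by (auto simp: Z_def h_def)
    ultimately show False using t_max[of "t + h"] by auto
  qed
  \<comment> \<open>Weak monotonicity becomes strict through a single point outside
    \<open>N\<close>: the negative derivative there produces an actual drop.\<close>
  have "\<not> negligible {a<..<b}" using \<open>a < b\<close> by (intro open_not_negligible) auto
  then have "\<not> {a<..<b} \<subseteq> N" using \<open>negligible N\<close> negligible_subset by blast
  then obtain t where t: "a < t" "t < b" "t \<notin> N"
    by (meson greaterThanLessThan_iff subsetI)
  with der obtain d' where "d' < 0" "(\<phi> has_real_derivative d') (at t)" by force
  then obtain e where e: "e > 0" "\<And>h. h > 0 \<Longrightarrow> h < e \<Longrightarrow> \<phi> (t + h) < \<phi> t"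
    using DERIV_neg_dec_right by blast
  define h where "h = min (e / 2) (b - t)"
  have "h > 0" "h < e" "t + h \<le> b" using e t by (auto simp: h_def)
  then have "\<phi> b \<le> \<phi> (t + h)" using t by (intro mono) auto
  also have "\<dots> < \<phi> t" using e \<open>h > 0\<close> \<open>h < e\<close> by blast
  also have "\<dots> \<le> \<phi> a" using t by (intro mono) auto
  finally show ?thesis .
qed

section \<open>Euler polygons\<close>

text \<open>The integral of the piecewise constant velocity \<open>u\<close>: for
  \<open>t \<ge> 0\<close> and nonnegative steps, the \<open>k\<close>-th weight is the part of
  [0, t] lying in the \<open>k\<close>-th step interval. This form avoids locating \<open>t\<close>
  among the nodes and makes the curve constant after the last one.\<close>

definition polygon :: "(nat \<Rightarrow> real) \<Rightarrow> (nat \<Rightarrow> 'a::real_normed_vector) \<Rightarrow> 'a \<Rightarrow> nat \<Rightarrow> real \<Rightarrow> 'a" where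
  "polygon \<alpha> u z N t =
    z + (\<Sum>k<N. (min t (\<Sum>i<Suc k. \<alpha> i) - min t (\<Sum>i<k. \<alpha> i)) *\<^sub>R u k)"

lemma polygon_diff:
  "polygon \<alpha> u z N t - polygon \<alpha> u z N s =
    (\<Sum>k<N. ((min t (\<Sum>i<Suc k. \<alpha> i) - min t (\<Sum>i<k. \<alpha> i)) -
      (min s (\<Sum>i<Suc k. \<alpha> i) - min s (\<Sum>i<k. \<alpha> i))) *\<^sub>R u k)"
  unfolding polygon_def by (simp add: sum_subtractf scaleR_diff_left del: sum.lessThan_Suc)

text \<open>The expression is the length of the overlap of [s, t] with [T, T'].\<close>

lemma polygon_weight_nonneg:
  fixes s t T T' :: real
  assumes "s \<le> t" "T \<le> T'"
  shows "0 \<le> (min t T' - min t T) - (min s T' - min s T)"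
  using assms by (auto simp: min_def)

lemma polygon_weight_sum:
  fixes \<alpha> :: "nat \<Rightarrow> real"
  shows "(\<Sum>k<N. (min t (\<Sum>i<Suc k. \<alpha> i) - min t (\<Sum>i<k. \<alpha> i)) -
      (min s (\<Sum>i<Suc k. \<alpha> i) - min s (\<Sum>i<k. \<alpha> i))) =
    (min t (\<Sum>i<N. \<alpha> i) - min t 0) - (min s (\<Sum>i<N. \<alpha> i) - min s 0)"
  by (induction N) (simp_all add: sum_subtractf)

lemma polygon_lipschitz:
  fixes u :: "nat \<Rightarrow> 'a::real_normed_vector"
  assumes pos: "\<And>k. 0 \<le> \<alpha> k" and bound: "\<And>k. k < N \<Longrightarrow> norm (u k) \<le> M" and "0 \<le> M"
  shows "norm (polygon \<alpha> u z N t - polygon \<alpha> u z N s) \<le> M * \<bar>t - s\<bar>"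
proof -
  have *: "norm (polygon \<alpha> u z N t - polygon \<alpha> u z N s) \<le> M * (t - s)" if "s \<le> t" for s t
  proof -
    define w where "w k = (min t (\<Sum>i<Suc k. \<alpha> i) - min t (\<Sum>i<k. \<alpha> i)) -
      (min s (\<Sum>i<Suc k. \<alpha> i) - min s (\<Sum>i<k. \<alpha> i))" for k
    have w: "0 \<le> w k" for k
      unfolding w_def by (rule polygon_weight_nonneg) (use that pos in auto)
    have T: "0 \<le> (\<Sum>i<N. \<alpha> i)" using pos by (simp add: sum_nonneg)
    have "norm (polygon \<alpha> u z N t - polygon \<alpha> u z N s) \<le> (\<Sum>k<N. norm (w k *\<^sub>R u k))"
      unfolding polygon_diff w_def by (rule norm_sum)
    also have "\<dots> \<le> (\<Sum>k<N. w k * M)"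
      using w bound by (intro sum_mono) (auto intro: mult_left_mono)
    also have "\<dots> = M * (\<Sum>k<N. w k)" by (simp add: sum_distrib_left mult.commute)
    also have "(\<Sum>k<N. w k) \<le> t - s"
      unfolding w_def polygon_weight_sum using that T by (auto simp: min_def)
    finally show ?thesis using \<open>0 \<le> M\<close> by (auto intro: mult_left_mono)
  qed
  show ?thesis
    using *[of s t] *[of t s] by (cases "s \<le> t") (auto simp: norm_minus_commute)
qed

lemma polygon_node:
  assumes pos: "\<And>k. 0 \<le> \<alpha> k" and "k \<le> N"
  shows "polygon \<alpha> u z N (\<Sum>i<k. \<alpha> i) = z + (\<Sum>i<k. \<alpha> i *\<^sub>R u i)"
proof -
  have mono: "(\<Sum>i<m. \<alpha> i) \<le> (\<Sum>i<n. \<alpha> i)" if "m \<le> n" for m n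
    using that pos by (intro sum_mono2) auto
  have "(\<Sum>j<N. (min (\<Sum>i<k. \<alpha> i) (\<Sum>i<Suc j. \<alpha> i) - min (\<Sum>i<k. \<alpha> i) (\<Sum>i<j. \<alpha> i)) *\<^sub>R u j)
      = (\<Sum>j<k. \<alpha> j *\<^sub>R u j)"
  proof (rule sum.mono_neutral_cong_right)
    show "\<forall>j\<in>{..<N} - {..<k}.
      (min (\<Sum>i<k. \<alpha> i) (\<Sum>i<Suc j. \<alpha> i) - min (\<Sum>i<k. \<alpha> i) (\<Sum>i<j. \<alpha> i)) *\<^sub>R u j = 0"
      using mono[of k] by (auto simp: min_absorb1 simp del: sum.lessThan_Suc)
    show "(min (\<Sum>i<k. \<alpha> i) (\<Sum>i<Suc j. \<alpha> i) - min (\<Sum>i<k. \<alpha> i) (\<Sum>i<j. \<alpha> i)) *\<^sub>R u j = \<alpha> j *\<^sub>R u j"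
      if "j \<in> {..<k}" for j
      using that mono[of "Suc j" k] mono[of j k] by (simp add: min_absorb2)
  qed (use \<open>k \<le> N\<close> in auto)
  then show ?thesis by (simp add: polygon_def del: sum.lessThan_Suc)
qed

text \<open>The slope is the average of the velocities \<open>u k\<close>, weighted by the overlap
  of the \<open>k\<close>-th step interval with [s, t]. The bound on \<open>t\<close> by the total
  time makes the weights sum to one.\<close>

lemma polygon_slope_in_convex:
  fixes u :: "nat \<Rightarrow> 'a::real_normed_vector"
  assumes pos: "\<And>k. 0 \<le> \<alpha> k" and "0 \<le> s" "s < t" "t \<le> (\<Sum>i<N. \<alpha> i)" and "convex V"
    and V: "\<And>k. k < N \<Longrightarrow> (\<Sum>i<k. \<alpha> i) < t \<Longrightarrow> s < (\<Sum>i<Suc k. \<alpha> i) \<Longrightarrow> u k \<in> V"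
  shows "(1 / (t - s)) *\<^sub>R (polygon \<alpha> u z N t - polygon \<alpha> u z N s) \<in> V"
proof -
  define w where "w k = ((min t (\<Sum>i<Suc k. \<alpha> i) - min t (\<Sum>i<k. \<alpha> i)) -
    (min s (\<Sum>i<Suc k. \<alpha> i) - min s (\<Sum>i<k. \<alpha> i)))" for k
  \<comment> \<open>Membership in \<open>V\<close> is known only for steps that overlap the
    interval, so indices of weight zero are removed before convexity is applied.\<close>
  define I where "I = {k\<in>{..<N}. w k \<noteq> 0}"
  have w: "0 \<le> w k" for k
    unfolding w_def by (rule polygon_weight_nonneg) (use assms in auto)
  have "(\<Sum>k<N. w k) = t - s"
    unfolding w_def polygon_weight_sum using assms by (auto simp: min_def)
  moreover have "(\<Sum>k\<in>I. w k) = (\<Sum>k<N. w k)"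
    by (rule sum.mono_neutral_left) (auto simp: I_def)
  ultimately have "(\<Sum>k\<in>I. w k / (t - s)) = 1"
    using \<open>s < t\<close> by (simp add: sum_divide_distrib[symmetric])
  moreover have "u k \<in> V" if "k \<in> I" for k
  proof (rule V)
    show "k < N" using that by (simp add: I_def)
    have "w k \<noteq> 0" using that by (simp add: I_def)
    moreover have "(\<Sum>i<k. \<alpha> i) \<le> (\<Sum>i<Suc k. \<alpha> i)" using pos by simp
    ultimately show "(\<Sum>i<k. \<alpha> i) < t" "s < (\<Sum>i<Suc k. \<alpha> i)"
      using \<open>s < t\<close> unfolding w_def by (auto simp: min_def split: if_splits)
  qed
  ultimately have "(\<Sum>k\<in>I. (w k / (t - s)) *\<^sub>R u k) \<in> V"
    using \<open>convex V\<close> w \<open>s < t\<close> by (intro convex_sum) (auto simp: I_def)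
  also have "(\<Sum>k\<in>I. (w k / (t - s)) *\<^sub>R u k) = (\<Sum>k<N. (w k / (t - s)) *\<^sub>R u k)"
    by (rule sum.mono_neutral_left) (auto simp: I_def)
  also have "\<dots> = (1 / (t - s)) *\<^sub>R (polygon \<alpha> u z N t - polygon \<alpha> u z N s)"
    unfolding polygon_diff w_def[symmetric] by (simp add: scaleR_sum_right)
  finally show ?thesis .
qed

section \<open>Upper semicontinuous maps and limits of Euler polygons\<close>

lemma usc_bounded_on_compact:
  fixes F :: "'a::metric_space \<Rightarrow> 'b::real_normed_vector set"
  assumes "upper_semicontinuous F" and "\<And>x. compact (F x)" and "compact K"
  obtains M where "M > 0" "\<And>x u. x \<in> K \<Longrightarrow> u \<in> F x \<Longrightarrow> norm u \<le> M"
proof -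
  have "\<exists>R U. open U \<and> x \<in> U \<and> (\<forall>y\<in>U. \<forall>u\<in>F y. norm u \<le> R)" for x
  proof -
    obtain R where "F x \<subseteq> ball 0 R"
      using bounded_subset_ballD[OF compact_imp_bounded[OF assms(2)]] by metis
    then obtain U where "open U" "x \<in> U" "(\<Union>y\<in>U. F y) \<subseteq> ball 0 R"
      using assms(1) unfolding upper_semicontinuous_def by (meson open_ball)
    then show ?thesis by (intro exI[of _ R] exI[of _ U]) (force simp: less_imp_le)
  qed
  then obtain R U where RU: "\<And>x. open (U x)" "\<And>x. x \<in> U x"
    "\<And>x y u. y \<in> U x \<Longrightarrow> u \<in> F y \<Longrightarrow> norm u \<le> R x"
    by metis
  obtain C where C: "finite C" "K \<subseteq> (\<Union>c\<in>C. U c)"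
    using compactE_image[OF \<open>compact K\<close>, of K U] RU(1,2) by (metis UN_I subsetI)
  show thesis
  proof
    \<comment> \<open>The inserted 1 makes the bound positive and keeps the maximum meaningful for
      an empty cover.\<close>
    show "Max (insert 1 (R ` C)) > 0"
      using C by (intro less_le_trans[OF zero_less_one] Max_ge) auto
    fix x u assume "x \<in> K" "u \<in> F x"
    then obtain c where "c \<in> C" "norm u \<le> R c" using C RU by blast
    then show "norm u \<le> Max (insert 1 (R ` C))"
      using C by (intro Max.coboundedI[THEN order_trans[rotated]]) auto
  qed
qed

text \<open>A velocity outside the convex hull would be separated from it by a hyperplane; by upper
  semicontinuity the open half-space contains all nearby values of \<open>F\<close>, hence all short-time
  slopes of the approximating polygons.\<close>

lemma limit_velocity_in_convex_hull:
  fixes F :: "'a::euclidean_space \<Rightarrow> 'a set" and y :: "nat \<Rightarrow> real \<Rightarrow> 'a"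
  assumes usc: "upper_semicontinuous F" and cpt: "\<And>x. compact (F x)" "\<And>x. F x \<noteq> {}"
    and lim: "\<And>s. 0 \<le> s \<Longrightarrow> s \<le> \<tau> \<Longrightarrow> (\<lambda>j. y j s) \<longlonglongrightarrow> \<gamma> s"
    and e: "e \<longlonglongrightarrow> 0" and "M > 0"
    and slope: "\<And>j s t V. 0 \<le> s \<Longrightarrow> s < t \<Longrightarrow> t \<le> \<tau> \<Longrightarrow> convex V \<Longrightarrow>
      (\<And>z. norm (z - y j s) \<le> M * (t - s + e j) \<Longrightarrow> F z \<subseteq> V) \<Longrightarrow>
      (1 / (t - s)) *\<^sub>R (y j t - y j s) \<in> V"
    and t: "0 < t" "t < \<tau>" and v: "(\<gamma> has_vector_derivative v) (at t)"
  shows "v \<in> convex hull (F (\<gamma> t))"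
proof (rule ccontr)
  assume "v \<notin> convex hull (F (\<gamma> t))"
  then obtain a b where ab: "a \<bullet> v < b" "\<And>u. u \<in> convex hull (F (\<gamma> t)) \<Longrightarrow> b < a \<bullet> u"
    using separating_hyperplane_closed_point[OF convex_convex_hull
        compact_imp_closed[OF compact_convex_hull[OF cpt(1)]]] by blast
  define V where "V = {u. b < a \<bullet> u}"
  have "F (\<gamma> t) \<subseteq> V" "open V" "convex V"
    using ab hull_subset[of "F (\<gamma> t)" convex]
    by (auto simp: V_def open_halfspace_gt convex_halfspace_gt)
  then obtain U where "open U" "\<gamma> t \<in> U" "(\<Union>x\<in>U. F x) \<subseteq> V"
    using usc unfolding upper_semicontinuous_def by meson
  then obtain r where r: "r > 0" "\<And>z. norm (z - \<gamma> t) < r \<Longrightarrow> F z \<subseteq> V"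
    by (fastforce simp: open_dist dist_norm)
  \<comment> \<open>Half of the radius \<open>r\<close> pays for the motion during time
    \<open>h\<close>; the other half absorbs, for large \<open>j\<close>, the step error
    \<open>M * e j\<close> and the distance of \<open>y j t\<close> from its limit.\<close>
  have quotient: "b \<le> a \<bullet> ((1 / h) *\<^sub>R (\<gamma> (t + h) - \<gamma> t))"
    if h: "0 < h" "h < r / (2 * M)" "h \<le> \<tau> - t" for h
  proof -
    have "(\<lambda>j. (1 / h) *\<^sub>R (y j (t + h) - y j t)) \<longlonglongrightarrow> (1 / h) *\<^sub>R (\<gamma> (t + h) - \<gamma> t)"
      using t h by (intro tendsto_intros lim) auto
    then have "(\<lambda>j. a \<bullet> ((1 / h) *\<^sub>R (y j (t + h) - y j t))) \<longlonglongrightarrow>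
        a \<bullet> ((1 / h) *\<^sub>R (\<gamma> (t + h) - \<gamma> t))"
      by (rule tendsto_inner[OF tendsto_const])
    moreover have "\<forall>\<^sub>F j in sequentially. b \<le> a \<bullet> ((1 / h) *\<^sub>R (y j (t + h) - y j t))"
    proof -
      have "(\<lambda>j. M * (h + e j) + norm (y j t - \<gamma> t)) \<longlonglongrightarrow> M * (h + 0) + norm (\<gamma> t - \<gamma> t)"
        using t by (intro tendsto_intros lim e) auto
      moreover have "M * h < r" using h \<open>M > 0\<close> r by (simp add: field_simps)
      ultimately have "\<forall>\<^sub>F j in sequentially. M * (h + e j) + norm (y j t - \<gamma> t) < r"
        by (intro order_tendstoD) auto
      then show ?thesis
      proof eventually_elim
        case (elim j)
        have "(1 / ((t + h) - t)) *\<^sub>R (y j (t + h) - y j t) \<in> V"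
        proof (rule slope)
          fix z assume "norm (z - y j t) \<le> M * (t + h - t + e j)"
          moreover have "norm (z - \<gamma> t) \<le> norm (z - y j t) + norm (y j t - \<gamma> t)"
            by (rule norm_diff_triangle_le[OF order_refl order_refl])
          ultimately show "F z \<subseteq> V" using elim by (intro r) simp
        qed (use t h \<open>convex V\<close> in auto)
        then show ?case by (simp add: V_def)
      qed
    qed
    ultimately show ?thesis by (rule tendsto_lowerbound) simp
  qed
  have "((\<lambda>s. a \<bullet> \<gamma> s) has_real_derivative (a \<bullet> v)) (at t)"
    unfolding has_real_derivative_iff_has_vector_derivative
    by (rule bounded_linear.has_vector_derivative[OF bounded_linear_inner_right v])
  then have "((\<lambda>h. (a \<bullet> \<gamma> (t + h) - a \<bullet> \<gamma> t) / h) \<longlongrightarrow> a \<bullet> v) (at 0)"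
    by (simp add: DERIV_def)
  then have "((\<lambda>h. (a \<bullet> \<gamma> (t + h) - a \<bullet> \<gamma> t) / h) \<longlongrightarrow> a \<bullet> v) (at_right 0)"
    by (rule tendsto_mono[rotated]) (simp add: at_le)
  then have "((\<lambda>h. a \<bullet> ((1 / h) *\<^sub>R (\<gamma> (t + h) - \<gamma> t))) \<longlongrightarrow> a \<bullet> v) (at_right 0)"
    by (simp add: inner_diff_right)
  moreover have "\<forall>\<^sub>F h in at_right 0. b \<le> a \<bullet> ((1 / h) *\<^sub>R (\<gamma> (t + h) - \<gamma> t))"
    unfolding eventually_at_right_field
    using quotient r \<open>M > 0\<close> t
    by (intro exI[of _ "min (r / (2 * M)) (\<tau> - t)"]) auto
  ultimately have "b \<le> a \<bullet> v" by (rule tendsto_lowerbound) simp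
  with ab show False by simp
qed

lemma lipschitz_absolutely_continuous_curve:
  assumes lip: "\<And>s t. s \<in> {c..d} \<Longrightarrow> t \<in> {c..d} \<Longrightarrow> norm (\<gamma> t - \<gamma> s) \<le> M * \<bar>t - s\<bar>" and "M > 0"
  shows "absolutely_continuous_curve c d \<gamma>"
  unfolding absolutely_continuous_curve_def
proof (intro allI impI)
  fix \<epsilon> :: real assume "\<epsilon> > 0"
  show "\<exists>\<delta>>0. \<forall>(m::nat) a b.
      (\<forall>i<m. c \<le> a i \<and> a i \<le> b i \<and> b i \<le> d) \<and>
      disjoint_family_on (\<lambda>i. {a i<..<b i}) {..<m} \<and>
      (\<Sum>i<m. b i - a i) < \<delta>
      \<longrightarrow> (\<Sum>i<m. norm (\<gamma> (b i) - \<gamma> (a i))) < \<epsilon>"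
  proof (intro exI[of _ "\<epsilon> / M"] conjI allI impI)
    show "\<epsilon> / M > 0" using \<open>\<epsilon> > 0\<close> \<open>M > 0\<close> by simp
    fix m :: nat and a b :: "nat \<Rightarrow> real"
    assume *: "(\<forall>i<m. c \<le> a i \<and> a i \<le> b i \<and> b i \<le> d) \<and>
      disjoint_family_on (\<lambda>i. {a i<..<b i}) {..<m} \<and> (\<Sum>i<m. b i - a i) < \<epsilon> / M"
    have "(\<Sum>i<m. norm (\<gamma> (b i) - \<gamma> (a i))) \<le> (\<Sum>i<m. M * (b i - a i))"
    proof (rule sum_mono)
      fix i assume "i \<in> {..<m}"
      with * have "c \<le> a i" "a i \<le> b i" "b i \<le> d" by blast+
      then show "norm (\<gamma> (b i) - \<gamma> (a i)) \<le> M * (b i - a i)"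
        using lip[of "a i" "b i"] by simp
    qed
    also have "\<dots> = M * (\<Sum>i<m. b i - a i)" by (simp add: sum_distrib_left)
    also have "\<dots> < \<epsilon>" using * \<open>M > 0\<close> by (simp add: field_simps)
    finally show "(\<Sum>i<m. norm (\<gamma> (b i) - \<gamma> (a i))) < \<epsilon>" .
  qed
qed

section \<open>Descent of the potential along Euler sequences\<close>

lemma euler_displacement:
  fixes x :: "nat \<Rightarrow> 'a::real_normed_vector"
  assumes "euler_sequence F \<alpha> x" and "j \<le> k"
    and M: "\<And>i u. j \<le> i \<Longrightarrow> i < k \<Longrightarrow> u \<in> F (x i) \<Longrightarrow> norm u \<le> M"
  shows "norm (x k - x j) \<le> M * ((\<Sum>i<k. \<alpha> i) - (\<Sum>i<j. \<alpha> i))"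
  using \<open>j \<le> k\<close> M
proof (induction k rule: dec_induct)
  case base
  then show ?case by simp
next
  case (step n)
  obtain u where u: "u \<in> F (x n)" "x (Suc n) = x n + \<alpha> n *\<^sub>R u" "\<alpha> n > 0"
    using assms(1) by (auto simp: euler_sequence_def)
  have "norm (x (Suc n) - x j) \<le> norm (x n - x j) + norm (\<alpha> n *\<^sub>R u)"
    unfolding u(2) by (metis add_diff_eq add.commute norm_triangle_ineq)
  also have "norm (x n - x j) \<le> M * ((\<Sum>i<n. \<alpha> i) - (\<Sum>i<j. \<alpha> i))" using step by simp
  also have "norm (\<alpha> n *\<^sub>R u) \<le> M * \<alpha> n"
    using u step.prems[of n u] step.hyps by (simp add: mult.commute mult_left_mono)
  finally show ?case by (simp add: algebra_simps)
qed

lemma euler_shift: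
  "euler_sequence F \<alpha> x \<Longrightarrow> euler_sequence F (\<lambda>k. \<alpha> (k + m)) (\<lambda>k. x (k + m))"
  by (simp add: euler_sequence_def)

text \<open>Compactness of \<open>D x\<close> and \<open>0 \<notin> D x\<close> make the minimum of
  \<open>\<kappa>\<close> positive. Real \<open>SUP\<close> and \<open>INF\<close> carry order
  information only on nonempty bounded sets, so boundedness of all the pairings is checked before a
  strictly negative one is extracted.\<close>

lemma velocity_pairing_negative:
  fixes F D :: "'a::euclidean_space \<Rightarrow> 'a set"
  assumes F: "compact (F x)" and D: "D x \<noteq> {}" "compact (D x)" "0 \<notin> D x"
    and \<kappa>: "\<kappa> \<in> pos_def_functions"
    and desc: "(SUP u\<in>convex hull (F x). INF v\<in>D x. u \<bullet> v) \<le> - (INF w\<in>D x. \<kappa> w)"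
    and u: "u \<in> convex hull (F x)"
  obtains v where "v \<in> D x" "u \<bullet> v < 0"
proof -
  have "continuous_on (D x) \<kappa>"
    using \<kappa> continuous_on_subset by (auto simp: pos_def_functions_def)
  then obtain w where w: "w \<in> D x" "\<And>w'. w' \<in> D x \<Longrightarrow> \<kappa> w \<le> \<kappa> w'"
    using continuous_attains_inf D by metis
  have "0 < \<kappa> w" using w(1) D(3) \<kappa> by (cases "w = 0") (auto simp: pos_def_functions_def)
  also have "\<kappa> w \<le> (INF w\<in>D x. \<kappa> w)" using D w by (intro cINF_greatest) auto
  finally have neg: "- (INF w\<in>D x. \<kappa> w) < 0" by simp
  have below: "bdd_below ((\<lambda>v. u' \<bullet> v) ` D x)" for u'
    by (intro bounded_imp_bdd_below compact_imp_bounded compact_continuous_image D continuous_intros)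
  obtain B where B: "\<And>u'. u' \<in> convex hull (F x) \<Longrightarrow> norm u' \<le> B"
    using compact_imp_bounded[OF compact_convex_hull[OF F]] by (auto simp: bounded_iff)
  have "bdd_above ((\<lambda>u'. INF v\<in>D x. u' \<bullet> v) ` (convex hull (F x)))"
  proof (rule bdd_aboveI2)
    fix u' assume u': "u' \<in> convex hull (F x)"
    have "(INF v\<in>D x. u' \<bullet> v) \<le> u' \<bullet> w" using w below by (intro cINF_lower) auto
    also have "\<dots> \<le> norm u' * norm w" by (rule norm_cauchy_schwarz)
    also have "\<dots> \<le> B * norm w" using B[OF u'] by (intro mult_right_mono) auto
    finally show "(INF v\<in>D x. u' \<bullet> v) \<le> B * norm w" .
  qed
  then have "(INF v\<in>D x. u \<bullet> v) \<le> (SUP u\<in>convex hull (F x). INF v\<in>D x. u \<bullet> v)"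
    using u by (intro cSUP_upper)
  with desc neg have "(INF v\<in>D x. u \<bullet> v) < 0" by linarith
  then show thesis using that D below by (auto simp: cINF_less_iff)
qed

locale euler_descent =
  fixes F D :: "'a::euclidean_space \<Rightarrow> 'a set" and f :: "'a \<Rightarrow> real"
  assumes usc: "upper_semicontinuous F"
    and F_values: "\<And>x. F x \<noteq> {}" "\<And>x. compact (F x)"
    and conservative: "conservative_field f D"
    and descent: "\<And>xhat. \<exists>\<rho>>0. \<exists>\<kappa>\<in>pos_def_functions. \<forall>x\<in>ball xhat \<rho>.
      (SUP u\<in>convex hull (F x). INF v\<in>D x. u \<bullet> v) \<le> - (INF w\<in>D x. \<kappa> w)"
begin

lemma lipschitz_near: "\<exists>r>0. \<exists>L. L-lipschitz_on (ball x r) f"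
  using conservative by (simp add: conservative_field_def locally_lipschitz_def)

lemma continuous_f: "continuous_on UNIV f"
proof -
  have "isCont f x" for x
  proof -
    obtain r L where "r > 0" "L-lipschitz_on (ball x r) f"
      using lipschitz_near by blast
    then show ?thesis
      using lipschitz_on_continuous_on continuous_on_eq_continuous_at[OF open_ball]
      by (metis centre_in_ball)
  qed
  then show ?thesis by (simp add: continuous_on_eq_continuous_at)
qed

text \<open>The descent condition yields just one element of \<open>D (\<gamma> t)\<close> with
  negative pairing. This suffices, because the chain rule gives \<open>f \<circ> \<gamma>\<close>
  the same derivative whichever element is paired with the velocity. The curve lives on [0, 1] to
  match the definition of a conservative field, while the inclusion is known up to
  \<open>\<tau>\<close> only.\<close>

lemma curve_descent:
  assumes lip: "\<And>s t. s \<in> {0..1} \<Longrightarrow> t \<in> {0..1} \<Longrightarrow> norm (\<gamma> t - \<gamma> s) \<le> M * \<bar>t - s\<bar>" "M > 0"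
    and \<tau>: "0 < \<tau>" "\<tau> \<le> 1"
    and inclusion: "\<And>t v. 0 < t \<Longrightarrow> t < \<tau> \<Longrightarrow> (\<gamma> has_vector_derivative v) (at t) \<Longrightarrow>
      v \<in> convex hull (F (\<gamma> t))"
    and noncritical: "\<And>t. 0 < t \<Longrightarrow> t < \<tau> \<Longrightarrow> 0 \<notin> D (\<gamma> t)"
  shows "f (\<gamma> \<tau>) < f (\<gamma> 0)"
proof -
  define P where "P t \<longleftrightarrow> t \<in> {0<..<1} \<longrightarrow>
    (\<exists>\<gamma>'. (\<gamma> has_vector_derivative \<gamma>') (at t) \<and>
      (\<forall>v\<in>D (\<gamma> t). ((f \<circ> \<gamma>) has_real_derivative (v \<bullet> \<gamma>')) (at t)))" for t
  have "absolutely_continuous_curve 0 1 \<gamma>"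
    using lip by (rule lipschitz_absolutely_continuous_curve)
  then have "AE t in lebesgue. P t"
    using conservative unfolding conservative_field_def P_def by blast
  then obtain N where N: "negligible N" "\<And>t. t \<notin> N \<Longrightarrow> P t"
    unfolding eventually_ae_filter negligible_iff_null_sets by auto
  have cont: "continuous_on {0..1} \<gamma>"
  proof (rule lipschitz_on_continuous_on)
    show "M-lipschitz_on {0..1} \<gamma>"
      using lip by (intro lipschitz_onI) (auto simp: dist_norm less_imp_le)
  qed
  have "(f \<circ> \<gamma>) \<tau> < (f \<circ> \<gamma>) 0"
  proof (rule strict_decrease_if_ae_negative_derivative[OF \<open>0 < \<tau>\<close> _ N(1)])
    show "continuous_on {0..\<tau>} (f \<circ> \<gamma>)"
      using \<tau> by (intro continuous_on_compose continuous_on_subset[OF cont]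
        continuous_on_subset[OF continuous_f]) auto
    fix t assume t: "t \<in> {0<..<\<tau>}"
    obtain r L where rL: "r > 0" "L-lipschitz_on (ball (\<gamma> t) r) f"
      using lipschitz_near by blast
    have "\<bar>(f \<circ> \<gamma>) s - (f \<circ> \<gamma>) t\<bar> \<le> (L * M) * \<bar>s - t\<bar>" if s: "s \<in> ball t (r / M) \<inter> {0<..<\<tau>}" for s
    proof -
      have le: "norm (\<gamma> s - \<gamma> t) \<le> M * \<bar>s - t\<bar>" using s t \<tau> by (intro lip) auto
      also have "\<dots> < r" using s \<open>M > 0\<close> by (simp add: dist_real_def field_simps abs_minus_commute)
      finally have "\<gamma> s \<in> ball (\<gamma> t) r" by (simp add: dist_norm norm_minus_commute)
      then have "dist (f (\<gamma> s)) (f (\<gamma> t)) \<le> L * dist (\<gamma> s) (\<gamma> t)"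
        using rL by (intro lipschitz_onD) auto
      also have "\<dots> \<le> L * (M * \<bar>s - t\<bar>)"
        using le lipschitz_on_nonneg[OF rL(2)] by (intro mult_left_mono) (auto simp: dist_norm)
      finally show ?thesis by (simp add: dist_real_def)
    qed
    then show "\<exists>T B. open T \<and> t \<in> T \<and> (\<forall>s\<in>T \<inter> {0<..<\<tau>}. \<bar>(f \<circ> \<gamma>) s - (f \<circ> \<gamma>) t\<bar> \<le> B * \<bar>s - t\<bar>)"
      using rL \<open>M > 0\<close> by (intro exI[of _ "ball t (r / M)"] exI[of _ "L * M"]) auto
  next
    fix t assume t: "t \<in> {0<..<\<tau>} - N"
    then obtain v where v: "(\<gamma> has_vector_derivative v) (at t)"
      "\<And>w. w \<in> D (\<gamma> t) \<Longrightarrow> ((f \<circ> \<gamma>) has_real_derivative (w \<bullet> v)) (at t)"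
      using N(2)[of t] \<tau> by (auto simp: P_def)
    obtain \<rho> \<kappa> where \<rho>\<kappa>: "\<rho> > 0" "\<kappa> \<in> pos_def_functions" "\<And>x. x \<in> ball (\<gamma> t) \<rho> \<Longrightarrow>
      (SUP u\<in>convex hull (F x). INF v\<in>D x. u \<bullet> v) \<le> - (INF w\<in>D x. \<kappa> w)"
      using descent[of "\<gamma> t"] by blast
    have D: "D (\<gamma> t) \<noteq> {}" "compact (D (\<gamma> t))"
      using conservative by (auto simp: conservative_field_def)
    have "0 \<notin> D (\<gamma> t)" using t by (intro noncritical) auto
    moreover have "v \<in> convex hull (F (\<gamma> t))" using t v(1) by (intro inclusion) auto
    moreover have "\<gamma> t \<in> ball (\<gamma> t) \<rho>" using \<rho>\<kappa>(1) by simp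
    ultimately obtain w where "w \<in> D (\<gamma> t)" "v \<bullet> w < 0"
      using velocity_pairing_negative[of F "\<gamma> t" D \<kappa> v, OF F_values(2) D _ \<rho>\<kappa>(2) \<rho>\<kappa>(3)]
      by blast
    then show "\<exists>d<0. (f \<circ> \<gamma> has_real_derivative d) (at t)"
      using v(2) by (metis inner_commute)
  qed
  then show ?thesis by simp
qed

text \<open>The constant \<open>c\<close> comes from a compactness argument by contradiction and is
  not explicit. Discrete times meet \<open>\<tau>\<close> only up to one step, hence the slack
  \<open>\<alpha>bar\<close> in the length of the window.\<close>

lemma window_descent:
  assumes S: "compact S" "\<And>x. x \<in> S \<Longrightarrow> 0 \<notin> D x" and \<tau>: "0 < \<tau>" "\<tau> \<le> 1"
  obtains \<alpha>bar c where "\<alpha>bar > 0" "c > 0"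
    "\<And>\<alpha> x N. range \<alpha> \<subseteq> {0<..\<alpha>bar} \<Longrightarrow> euler_sequence F \<alpha> x \<Longrightarrow> (\<And>k. k \<le> N \<Longrightarrow> x k \<in> S) \<Longrightarrow>
      \<tau> \<le> (\<Sum>i<N. \<alpha> i) \<Longrightarrow> (\<Sum>i<N. \<alpha> i) \<le> \<tau> + \<alpha>bar \<Longrightarrow> f (x N) \<le> f (x 0) - c"
proof (rule ccontr)
  assume no: "\<not> thesis"
  \<comment> \<open>One null sequence serves both as step bound and as the decrease that the
    counterexamples fail to achieve.\<close>
  define e where "e j = inverse (real (Suc j))" for j
  have e_pos: "e j > 0" for j by (simp add: e_def)
  have "\<exists>\<alpha> x N. range \<alpha> \<subseteq> {0<..e j} \<and> euler_sequence F \<alpha> x \<and> (\<forall>k\<le>N. x k \<in> S) \<and>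
    \<tau> \<le> (\<Sum>i<N. \<alpha> i) \<and> (\<Sum>i<N. \<alpha> i) \<le> \<tau> + e j \<and> f (x 0) - e j < f (x N)" for j
  proof (rule ccontr)
    assume "\<not> ?thesis"
    with no that[of "e j" "e j"] e_pos[of j] show False by (meson not_less)
  qed
  then obtain \<alpha> x N where seq: "\<And>j. range (\<alpha> j) \<subseteq> {0<..e j}" "\<And>j. euler_sequence F (\<alpha> j) (x j)"
    and xS: "\<And>j k. k \<le> N j \<Longrightarrow> x j k \<in> S"
    and time: "\<And>j. \<tau> \<le> (\<Sum>i<N j. \<alpha> j i)" "\<And>j. (\<Sum>i<N j. \<alpha> j i) \<le> \<tau> + e j"
    and almost_ascent: "\<And>j. f (x j 0) - e j < f (x j (N j))"
    by metis
  have \<alpha>: "0 < \<alpha> j i" "\<alpha> j i \<le> e j" for j i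
    using seq(1)[of j] by (meson greaterThanAtMost_iff range_subsetD)+
  obtain M where M: "M > 0" "\<And>z u. z \<in> S \<Longrightarrow> u \<in> F z \<Longrightarrow> norm u \<le> M"
    using usc_bounded_on_compact[OF usc F_values(2) S(1)] by metis
  have "\<forall>j k. \<exists>u. u \<in> F (x j k) \<and> x j (Suc k) = x j k + \<alpha> j k *\<^sub>R u"
    using seq(2) unfolding euler_sequence_def image_iff Bex_def by blast
  then obtain u where u: "\<And>j k. u j k \<in> F (x j k)" "\<And>j k. x j (Suc k) = x j k + \<alpha> j k *\<^sub>R u j k"
    by metis
  define T where "T j k = (\<Sum>i<k. \<alpha> j i)" for j k
  define y where "y j = polygon (\<alpha> j) (u j) (x j 0) (N j)" for j
  have "x j 0 + (\<Sum>i<k. \<alpha> j i *\<^sub>R u j i) = x j k" for j k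
    by (induction k) (simp_all add: u(2) flip: add.assoc)
  then have node: "y j (T j k) = x j k" if "k \<le> N j" for j k
    using that \<alpha>(1) by (simp add: y_def T_def polygon_node less_imp_le)
  have u_le: "norm (u j k) \<le> M" if "k < N j" for j k
    using that by (intro M(2)[OF xS u(1)]) simp
  have y_lip: "norm (y j t - y j s) \<le> M * \<bar>t - s\<bar>" for j s t
    unfolding y_def using \<alpha>(1) M(1) u_le by (intro polygon_lipschitz) (auto simp: less_imp_le)
  have y0: "y j 0 = x j 0" for j using node[of 0 j] by (simp add: T_def)
  obtain R where R: "\<And>z. z \<in> S \<Longrightarrow> norm z \<le> R"
    using compact_imp_bounded[OF S(1)] by (auto simp: bounded_iff)
  \<comment> \<open>The polygons share the Lipschitz constant \<open>M\<close> on the whole line, so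
    the limit exists on all of [0, 1] even if the window ends earlier.\<close>
  obtain \<gamma> r where r: "strict_mono (r :: nat \<Rightarrow> nat)"
    and unif: "\<And>\<epsilon>. 0 < \<epsilon> \<Longrightarrow> \<exists>n0. \<forall>n t. n \<ge> n0 \<and> t \<in> {0..1} \<longrightarrow> norm (y (r n) t - \<gamma> t) < \<epsilon>"
  proof (rule Arzela_Ascoli[of "{0..1::real}" y "R + M"])
    fix n and t :: real assume t: "t \<in> {0..1}"
    have "norm (y n t) \<le> norm (y n 0) + norm (y n t - y n 0)" by (rule norm_triangle_sub)
    also have "norm (y n 0) \<le> R" unfolding y0 by (intro R xS) simp
    also have "norm (y n t - y n 0) \<le> M * \<bar>t - 0\<bar>" by (rule y_lip)
    also have "\<dots> \<le> M * 1" using t M by (intro mult_left_mono) auto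
    finally show "norm (y n t) \<le> R + M" by simp
  next
    fix t \<epsilon> :: real assume "0 < \<epsilon>"
    have "norm (y n t - y n s) < \<epsilon>" if "norm (t - s) < \<epsilon> / M" for n s
    proof -
      have "norm (y n t - y n s) \<le> M * \<bar>t - s\<bar>" by (rule y_lip)
      also have "\<dots> < \<epsilon>" using that M by (simp add: field_simps)
      finally show ?thesis .
    qed
    then show "\<exists>d>0. \<forall>n s. s \<in> {0..1} \<and> norm (t - s) < d \<longrightarrow> norm (y n t - y n s) < \<epsilon>"
      using \<open>0 < \<epsilon>\<close> M by (intro exI[of _ "\<epsilon> / M"]) auto
  qed auto
  have lim: "(\<lambda>j. y (r j) t) \<longlonglongrightarrow> \<gamma> t" if "0 \<le> t" "t \<le> 1" for t
    unfolding LIMSEQ_iff using unif that by (meson atLeastAtMost_iff)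
  have "e \<longlonglongrightarrow> 0" unfolding e_def by (rule LIMSEQ_inverse_real_of_nat)
  then have e_lim: "(\<lambda>j. e (r j)) \<longlonglongrightarrow> 0"
    using LIMSEQ_subseq_LIMSEQ[OF _ r] by (simp add: o_def)
  have lim_near: "z \<longlonglongrightarrow> \<gamma> t"
    if "0 \<le> t" "t \<le> 1" "\<And>j. norm (z j - y (r j) t) \<le> M * e (r j)" for z t
  proof -
    have "(\<lambda>j. M * e (r j)) \<longlonglongrightarrow> 0" using tendsto_mult_left[OF e_lim, of M] by simp
    then have "(\<lambda>j. z j - y (r j) t) \<longlonglongrightarrow> 0"
      by (rule Lim_null_comparison[rotated]) (use that in simp)
    from tendsto_add[OF this lim[OF that(1,2)]] show ?thesis by simp
  qed
  have \<gamma>_lip: "norm (\<gamma> t - \<gamma> s) \<le> M * \<bar>t - s\<bar>" if "s \<in> {0..1}" "t \<in> {0..1}" for s t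
  proof (rule LIMSEQ_le_const2)
    show "(\<lambda>j. norm (y (r j) t - y (r j) s)) \<longlonglongrightarrow> norm (\<gamma> t - \<gamma> s)"
      using that by (intro tendsto_norm tendsto_diff lim) auto
  qed (use y_lip in blast)
  \<comment> \<open>Only the nodes are known to lie in \<open>S\<close>. A node at most
    \<open>e j\<close> before \<open>t\<close> lies within \<open>M * e j\<close> of the polygon, so
    such nodes converge to \<open>\<gamma> t\<close> and closedness of \<open>S\<close>
    applies.\<close>
  have \<gamma>_S: "\<gamma> t \<in> S" if t: "0 \<le> t" "t \<le> \<tau>" for t
  proof -
    have "\<exists>k\<le>N j. norm (x j k - y j t) \<le> M * e j" for j
    proof -
      obtain k where k: "k \<le> N j" "T j k \<le> t" "t \<le> T j k + e j"
      proof (cases "T j (N j) \<le> t")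
        case True
        then show thesis using that[of "N j"] time(1)[of j] t e_pos[of j] by (auto simp: T_def)
      next
        case False
        then have "t < T j (N j)" by simp
        define n where "n = (LEAST n. t < T j n)"
        have n: "t < T j n" "n \<le> N j"
          unfolding n_def using \<open>t < T j (N j)\<close> by (rule LeastI, rule Least_le)
        moreover from n t have "n \<noteq> 0" by (cases n) (auto simp: T_def)
        ultimately obtain k where k: "n = Suc k" using not0_implies_Suc by blast
        then have "k < n" by simp
        then have "\<not> t < T j k" unfolding n_def by (rule not_less_Least)
        with n k \<alpha>(2)[of j k] show thesis by (intro that[of k]) (auto simp: T_def)
      qed
      have "norm (x j k - y j t) \<le> M * \<bar>T j k - t\<bar>"
        using y_lip[of j "T j k" t] node[OF k(1)] by simp
      also have "\<dots> \<le> M * e j" using k M by (intro mult_left_mono) auto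
      finally show ?thesis using k(1) by blast
    qed
    then obtain k where k: "\<And>j. k j \<le> N j" "\<And>j. norm (x j (k j) - y j t) \<le> M * e j" by metis
    have "(\<lambda>j. x (r j) (k (r j))) \<longlonglongrightarrow> \<gamma> t"
      using t \<tau> k(2) by (intro lim_near) auto
    then show ?thesis
      by (rule closed_sequentially[OF compact_imp_closed[OF S(1)] xS[OF k(1)]])
  qed
  have "v \<in> convex hull (F (\<gamma> t))"
    if t: "0 < t" "t < \<tau>" and v: "(\<gamma> has_vector_derivative v) (at t)" for t v
  proof (rule limit_velocity_in_convex_hull[OF usc F_values(2,1) _ e_lim M(1) _ t v])
    show "(\<lambda>j. y (r j) s) \<longlonglongrightarrow> \<gamma> s" if "0 \<le> s" "s \<le> \<tau>" for s
      using that \<tau> by (intro lim) auto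
    fix j s t V
    assume st: "0 \<le> s" "s < t" "t \<le> \<tau>" and "convex (V :: 'a set)"
      and V: "\<And>z. norm (z - y (r j) s) \<le> M * (t - s + e (r j)) \<Longrightarrow> F z \<subseteq> V"
    show "(1 / (t - s)) *\<^sub>R (y (r j) t - y (r j) s) \<in> V"
      unfolding y_def
    proof (rule polygon_slope_in_convex)
      \<comment> \<open>A step that overlaps the interval may have begun before \<open>s\<close>,
        but by less than one step; this is the origin of the term \<open>e\<close> in the
        radius.\<close>
      fix k assume k: "k < N (r j)" "(\<Sum>i<k. \<alpha> (r j) i) < t" "s < (\<Sum>i<Suc k. \<alpha> (r j) i)"
      have "norm (x (r j) k - y (r j) s) \<le> M * \<bar>T (r j) k - s\<bar>"
        using y_lip[of "r j" "T (r j) k" s] node[of k "r j"] k(1) by simp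
      also have "\<dots> \<le> M * (t - s + e (r j))"
        using k st M \<alpha>[of "r j" k] by (intro mult_left_mono) (auto simp: T_def)
      finally have "F (x (r j) k) \<subseteq> V" by (rule V)
      with u(1) show "u (r j) k \<in> V" by (rule subsetD[rotated])
    qed (use st time(1)[of "r j"] \<alpha>(1) \<open>convex V\<close> in \<open>auto simp: less_imp_le\<close>)
  qed
  then have "f (\<gamma> \<tau>) < f (\<gamma> 0)"
    using \<gamma>_lip M(1) \<tau> S(2) \<gamma>_S by (intro curve_descent[of \<gamma> M]) (auto simp: less_imp_le)
  moreover have "f (\<gamma> 0) \<le> f (\<gamma> \<tau>)"
  proof (rule LIMSEQ_le)
    have f_lim: "(\<lambda>j. f (z j)) \<longlonglongrightarrow> f l" if "z \<longlonglongrightarrow> l" for z :: "nat \<Rightarrow> 'a" and l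
      using continuous_f that by (auto intro: continuous_on_tendsto_compose)
    have "(\<lambda>j. x (r j) 0) \<longlonglongrightarrow> \<gamma> 0" using lim[of 0] by (simp add: y0)
    from tendsto_diff[OF f_lim[OF this] e_lim]
    show "(\<lambda>j. f (x (r j) 0) - e (r j)) \<longlonglongrightarrow> f (\<gamma> 0)" by simp
    have "norm (x j (N j) - y j \<tau>) \<le> M * e j" for j
    proof -
      have "norm (x j (N j) - y j \<tau>) \<le> M * \<bar>T j (N j) - \<tau>\<bar>"
        using y_lip[of j "T j (N j)" \<tau>] node[of "N j" j] by simp
      also have "\<dots> \<le> M * e j"
        using time[of j] M by (intro mult_left_mono) (auto simp: T_def)
      finally show ?thesis .
    qed
    then show "(\<lambda>j. f (x (r j) (N (r j)))) \<longlonglongrightarrow> f (\<gamma> \<tau>)"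
      using \<tau> by (intro f_lim lim_near) auto
    show "\<exists>n0. \<forall>j\<ge>n0. f (x (r j) 0) - e (r j) \<le> f (x (r j) (N (r j)))"
      using almost_ascent by (meson less_imp_le)
  qed
  ultimately show False by simp
qed

section \<open>Invariance and decay of the levels of the potential\<close>

lemma sum_lessThan_shift:
  fixes \<alpha> :: "nat \<Rightarrow> 'b::ab_group_add"
  assumes "i \<le> k"
  shows "(\<Sum>n<k - i. \<alpha> (n + i)) = (\<Sum>n<k. \<alpha> n) - (\<Sum>n<i. \<alpha> n)"
  using assms by (induction k rule: dec_induct) (simp_all add: Suc_diff_le)

lemma compact_level_band:
  "compact K \<Longrightarrow> compact (K \<inter> {x. a \<le> f x \<and> f x \<le> b})"
  by (intro compact_Int_closed closed_Collect_conj closed_Collect_le continuous_on_const continuous_f)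

text \<open>If \<open>f\<close> exceeded \<open>l\<close> for the first time at step \<open>k\<close>, then during the last \<open>\<tau>\<close> units of time
  \<open>f\<close> would have stayed in a band of noncritical values, and \<open>f (x k)\<close> would lie strictly below an
  earlier value, which is at most \<open>l\<close>.\<close>

lemma stays_below:
  assumes K: "compact K" and l: "0 < l" "l < lbar"
    and noncritical: "\<And>x. 0 < f x \<Longrightarrow> f x < lbar \<Longrightarrow> 0 \<notin> D x"
  obtains \<alpha>bar where "\<alpha>bar > 0"
    "\<And>\<alpha> x k. range \<alpha> \<subseteq> {0<..\<alpha>bar} \<Longrightarrow> euler_sequence F \<alpha> x \<Longrightarrow> f (x 0) \<le> l / 2 \<Longrightarrow>
      (\<And>i. i \<le> k \<Longrightarrow> x i \<in> K) \<Longrightarrow> f (x k) \<le> l"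
proof -
  \<comment> \<open>The band extends above \<open>l\<close> since its last point has jumped over
    \<open>l\<close>; it ends halfway to \<open>lbar\<close>, where values are still noncritical.
    The two entries of the minimum bounding the oscillation below match its two edges.\<close>
  define S where "S = K \<inter> {x. l / 2 \<le> f x \<and> f x \<le> (l + lbar) / 2}"
  have "compact S" unfolding S_def by (rule compact_level_band[OF K])
  moreover have "0 \<notin> D x" if "x \<in> S" for x
    using that l by (intro noncritical) (auto simp: S_def)
  moreover obtain M where M: "M > 0" "\<And>z u. z \<in> K \<Longrightarrow> u \<in> F z \<Longrightarrow> norm u \<le> M"
    using usc_bounded_on_compact[OF usc F_values(2) K] by metis
  moreover obtain r where r: "r > 0"
    "\<And>y z. y \<in> K \<Longrightarrow> z \<in> K \<Longrightarrow> norm (y - z) < r \<Longrightarrow> \<bar>f y - f z\<bar> < min (l / 2) ((lbar - l) / 2)"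
  proof -
    have "uniformly_continuous_on K f"
      using K continuous_f continuous_on_subset by (blast intro: compact_uniformly_continuous)
    moreover have "0 < min (l / 2) ((lbar - l) / 2)" using l by simp
    ultimately show thesis
      unfolding uniformly_continuous_on_def dist_norm real_norm_def by (metis that)
  qed
  \<comment> \<open>A window costs a displacement of at most \<open>r / 2\<close>, its overshoot by
    one step at most \<open>r / 4\<close>.\<close>
  moreover define \<tau> where "\<tau> = min 1 (r / (2 * M))"
  ultimately have \<tau>: "0 < \<tau>" "\<tau> \<le> 1" by auto
  obtain \<alpha>1 c where window: "\<alpha>1 > 0" "c > 0"
    "\<And>\<alpha> x N. range \<alpha> \<subseteq> {0<..\<alpha>1} \<Longrightarrow> euler_sequence F \<alpha> x \<Longrightarrow> (\<And>k. k \<le> N \<Longrightarrow> x k \<in> S) \<Longrightarrow>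
      \<tau> \<le> (\<Sum>i<N. \<alpha> i) \<Longrightarrow> (\<Sum>i<N. \<alpha> i) \<le> \<tau> + \<alpha>1 \<Longrightarrow> f (x N) \<le> f (x 0) - c"
    using window_descent[OF \<open>compact S\<close> \<open>\<And>x. x \<in> S \<Longrightarrow> 0 \<notin> D x\<close> \<tau>] by metis
  define \<alpha>bar where "\<alpha>bar = min \<alpha>1 (r / (4 * M))"
  have \<alpha>bar: "\<alpha>bar > 0" "\<alpha>bar \<le> \<alpha>1" "M * (\<tau> + \<alpha>bar) < r"
  proof -
    show "\<alpha>bar > 0" "\<alpha>bar \<le> \<alpha>1" using window r M by (auto simp: \<alpha>bar_def)
    have "\<tau> + \<alpha>bar \<le> r / (2 * M) + r / (4 * M)" by (auto simp: \<alpha>bar_def \<tau>_def intro: add_mono)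
    then have "M * (\<tau> + \<alpha>bar) \<le> M * (r / (2 * M) + r / (4 * M))"
      using M(1) by (intro mult_left_mono) auto
    also have "\<dots> < r" using M(1) r(1) by (simp add: field_simps)
    finally show "M * (\<tau> + \<alpha>bar) < r" .
  qed
  show thesis
  proof (rule that[OF \<alpha>bar(1)], rule ccontr)
    fix \<alpha> x k
    assume \<alpha>: "range \<alpha> \<subseteq> {0<..\<alpha>bar}" and euler: "euler_sequence F \<alpha> x" and x0: "f (x 0) \<le> l / 2"
      and xK: "\<And>i. i \<le> k \<Longrightarrow> x i \<in> K" and "\<not> f (x k) \<le> l"
    define m where "m = (LEAST m. l < f (x m))"
    have m: "l < f (x m)" "m \<le> k" and before: "\<And>i. i < m \<Longrightarrow> f (x i) \<le> l"
      unfolding m_def using \<open>\<not> f (x k) \<le> l\<close>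
      by (auto simp: not_le intro: LeastI Least_le dest: not_less_Least)
    have step: "0 < \<alpha> i" "\<alpha> i \<le> \<alpha>bar" for i
      using \<alpha> by (meson greaterThanAtMost_iff range_subsetD)+
    define T where "T i = (\<Sum>n<i. \<alpha> n)" for i
    have near: "f (x m) - f (x i) < l / 2" "f (x m) - f (x i) < (lbar - l) / 2"
      if "i \<le> m" "T m - T i \<le> \<tau> + \<alpha>bar" for i
    proof -
      have "norm (x m - x i) \<le> M * (T m - T i)"
        unfolding T_def using that(1) m(2) by (intro euler_displacement[OF euler] M(2)[OF xK]) auto
      also have "\<dots> \<le> M * (\<tau> + \<alpha>bar)" using that(2) M(1) by (intro mult_left_mono) auto
      also have "\<dots> < r" by (rule \<alpha>bar)
      finally have "\<bar>f (x m) - f (x i)\<bar> < min (l / 2) ((lbar - l) / 2)"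
        using that(1) m(2) by (intro r(2) xK) auto
      then show "f (x m) - f (x i) < l / 2" "f (x m) - f (x i) < (lbar - l) / 2"
        by (simp_all only: min_less_iff_conj abs_less_iff)
    qed
    define P where "P i \<longleftrightarrow> i \<le> m \<and> \<tau> \<le> T m - T i" for i
    \<comment> \<open>Rising from at most \<open>l / 2\<close> to above \<open>l\<close> exceeds the
      oscillation allowed within a window, so a full window fits between 0 and
      \<open>m\<close>.\<close>
    have "P 0"
    proof (rule ccontr)
      assume "\<not> P 0"
      then have "T m - T 0 \<le> \<tau> + \<alpha>bar" using \<alpha>bar(1) by (auto simp: P_def)
      from near(1)[OF le0 this] m x0 show False by simp
    qed
    \<comment> \<open>The latest admissible start: the elapsed time then exceeds
      \<open>\<tau>\<close> by less than one step.\<close>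
    define i where "i = (GREATEST i. P i)"
    have "P i" unfolding i_def by (rule GreatestI_nat[of P 0 m]) (use \<open>P 0\<close> in \<open>auto simp: P_def\<close>)
    then have "i < m" using \<tau> by (cases "i = m") (auto simp: P_def)
    have "\<not> P (Suc i)"
    proof
      assume "P (Suc i)"
      then have "Suc i \<le> i"
        unfolding i_def by (rule Greatest_le_nat[of P _ m]) (simp add: P_def)
      then show False by simp
    qed
    then have upper: "T m - T i \<le> \<tau> + \<alpha>bar"
      using \<open>i < m\<close> step(2)[of i] by (auto simp: P_def T_def)
    have T_mono: "T i \<le> T j" if "i \<le> j" for j
      unfolding T_def using that step(1) by (intro sum_mono2) (auto simp: less_imp_le)
    have "f (x (m - i + i)) \<le> f (x (0 + i)) - c"
    proof (rule window(3)[of "\<lambda>n. \<alpha> (n + i)" "\<lambda>n. x (n + i)"])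
      show "range (\<lambda>n. \<alpha> (n + i)) \<subseteq> {0<..\<alpha>1}"
        using step(1) order_trans[OF step(2) \<alpha>bar(2)] by auto
      show "euler_sequence F (\<lambda>n. \<alpha> (n + i)) (\<lambda>n. x (n + i))" by (rule euler_shift[OF euler])
      show "\<tau> \<le> (\<Sum>n<m - i. \<alpha> (n + i))" "(\<Sum>n<m - i. \<alpha> (n + i)) \<le> \<tau> + \<alpha>1"
        using \<open>P i\<close> upper \<alpha>bar(2) \<open>i < m\<close> by (auto simp: sum_lessThan_shift P_def T_def)
      fix n assume n: "n \<le> m - i"
      have "f (x m) - f (x (n + i)) < l / 2"
        using n \<open>i < m\<close> upper T_mono[of "n + i"] by (intro near(1)) auto
      then have lower: "l / 2 \<le> f (x (n + i))" using m(1) by simp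
      have "f (x (n + i)) \<le> (l + lbar) / 2"
      proof (cases "n + i = m")
        \<comment> \<open>The endpoint alone lies above \<open>l\<close>; its predecessor is at most
          \<open>l\<close>, and one step adds less than half the gap to \<open>lbar\<close>.\<close>
        case True
        obtain q where q: "m = Suc q" using \<open>i < m\<close> by (cases m) auto
        have "T m - T q \<le> \<tau> + \<alpha>bar"
          using step(2)[of q] \<tau> by (simp add: T_def q)
        then have "f (x m) - f (x q) < (lbar - l) / 2" by (intro near(2)) (simp add: q)
        with before[of q] show ?thesis
          unfolding True by (simp add: q diff_divide_distrib add_divide_distrib)
      next
        case False
        then have "f (x (n + i)) \<le> l" using n \<open>i < m\<close> by (intro before) auto
        with l show ?thesis by (simp add: add_divide_distrib)
      qed
      with lower show "x (n + i) \<in> S"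
        unfolding S_def using n m(2) \<open>i < m\<close> xK[of "n + i"] by simp
    qed
    then have "f (x m) < f (x i)" using \<open>i < m\<close> window(2) by simp
    with before[OF \<open>i < m\<close>] m(1) show False by simp
  qed
qed

text \<open>While \<open>f\<close> stays above \<open>a\<close>, each time window of length 1 costs
  a fixed amount \<open>c\<close>, and divergence of the steps provides infinitely many windows. The
  admissible step size depends on \<open>a\<close>, whence the assumption that the steps
  vanish.\<close>

lemma falls_below:
  assumes K: "compact K" and "0 < a" and "b < lbar"
    and noncritical: "\<And>x. 0 < f x \<Longrightarrow> f x < lbar \<Longrightarrow> 0 \<notin> D x"
    and euler: "euler_sequence F \<alpha> x" and \<alpha>: "\<alpha> \<longlonglongrightarrow> 0" "\<not> summable \<alpha>"
    and xK: "\<And>k. x k \<in> K" and xb: "\<And>k. f (x k) \<le> b"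
  shows "\<exists>k\<ge>k0. f (x k) \<le> a"
proof (rule ccontr)
  assume "\<not> ?thesis"
  then have above: "a < f (x k)" if "k \<ge> k0" for k using that not_less by blast
  define S where "S = K \<inter> {x. a \<le> f x \<and> f x \<le> b}"
  have S: "compact S" unfolding S_def by (rule compact_level_band[OF K])
  have "0 \<notin> D y" if "y \<in> S" for y
    using that \<open>0 < a\<close> \<open>b < lbar\<close> by (intro noncritical) (auto simp: S_def)
  then obtain \<alpha>1 c where window: "\<alpha>1 > 0" "c > 0"
    "\<And>\<alpha> x N. range \<alpha> \<subseteq> {0<..\<alpha>1} \<Longrightarrow> euler_sequence F \<alpha> x \<Longrightarrow> (\<And>k. k \<le> N \<Longrightarrow> x k \<in> S) \<Longrightarrow>
      1 \<le> (\<Sum>i<N. \<alpha> i) \<Longrightarrow> (\<Sum>i<N. \<alpha> i) \<le> 1 + \<alpha>1 \<Longrightarrow> f (x N) \<le> f (x 0) - c"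
    using window_descent[OF S, of 1] by (metis order_refl zero_less_one)
  have pos: "0 < \<alpha> k" for k using euler by (simp add: euler_sequence_def)
  have "\<forall>\<^sub>F k in sequentially. \<alpha> k < \<alpha>1" using \<alpha>(1) window(1) by (rule order_tendstoD)
  then obtain k1 where k1: "\<And>k. k \<ge> k1 \<Longrightarrow> \<alpha> k < \<alpha>1" by (auto simp: eventually_sequentially)
  have "\<exists>k\<ge>max k0 k1. f (x k) \<le> b - real n * c" for n
  proof (induction n)
    case 0
    then show ?case using xb by (intro exI[of _ "max k0 k1"]) auto
  next
    case (Suc n)
    then obtain k where k: "k \<ge> max k0 k1" "f (x k) \<le> b - real n * c" by blast
    have ex: "\<exists>N. 1 \<le> (\<Sum>i<N. \<alpha> (i + k))"
    proof (rule ccontr)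
      assume "\<nexists>N. 1 \<le> (\<Sum>i<N. \<alpha> (i + k))"
      then have "summable (\<lambda>i. \<alpha> (i + k))"
        using pos by (intro summableI_nonneg_bounded[where x = 1]) (auto simp: less_imp_le not_le)
      then show False using \<alpha>(2) by (simp add: summable_iff_shift)
    qed
    \<comment> \<open>Minimality bounds the overshoot: the sum without the last step is below
      1.\<close>
    define N where "N = (LEAST N. 1 \<le> (\<Sum>i<N. \<alpha> (i + k)))"
    have N: "1 \<le> (\<Sum>i<N. \<alpha> (i + k))"
      unfolding N_def using ex by (rule LeastI_ex)
    then obtain N' where N': "N = Suc N'" by (cases N) auto
    then have "\<not> 1 \<le> (\<Sum>i<N'. \<alpha> (i + k))"
      unfolding N_def by (metis lessI not_less_Least)
    have "f (x (N + k)) \<le> f (x (0 + k)) - c"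
    proof (rule window(3)[of "\<lambda>i. \<alpha> (i + k)" "\<lambda>i. x (i + k)"])
      show "range (\<lambda>i. \<alpha> (i + k)) \<subseteq> {0<..\<alpha>1}"
        using pos k1 k(1) by (auto simp: less_imp_le)
      show "(\<Sum>i<N. \<alpha> (i + k)) \<le> 1 + \<alpha>1"
        using \<open>\<not> 1 \<le> (\<Sum>i<N'. \<alpha> (i + k))\<close> k1[of "N' + k"] k(1) by (simp add: N')
      show "x (i + k) \<in> S" for i
        using xK xb above[of "i + k"] k(1) by (auto simp: S_def less_imp_le)
    qed (use N euler_shift[OF euler] in auto)
    with k show ?case by (intro exI[of _ "N + k"]) (auto simp: algebra_simps)
  qed
  moreover obtain n where "b < real n * c" using reals_Archimedean3[OF window(2)] by blast
  ultimately obtain k where "k \<ge> k0" "f (x k) < 0"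
    by (metis diff_less_0_iff_less le_less_trans max.boundedE)
  with above[of k] \<open>0 < a\<close> show False by simp
qed

end

section \<open>Lyapunov functions on the zero set of the potential\<close>

text \<open>Outside \<open>U\<close> the function has a positive minimum on \<open>K\<close>; half
  of it serves as \<open>m\<close>. For nonnegative functions this passes from their zeros to points
  where they are merely small.\<close>

lemma sublevel_subset_open:
  fixes h :: "'a::t2_space \<Rightarrow> real"
  assumes "compact K" and "continuous_on K h" and "open U"
    and "\<And>x. x \<in> K \<Longrightarrow> h x \<le> 0 \<Longrightarrow> x \<in> U"
  obtains m where "m > 0" "\<And>x. x \<in> K \<Longrightarrow> h x \<le> m \<Longrightarrow> x \<in> U"
proof (cases "K - U = {}")
  case True
  then show thesis using that[of 1] by auto
next
  case False
  have "compact (K - U)" using assms by (intro compact_diff)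
  moreover have "continuous_on (K - U) h" using assms(2) by (rule continuous_on_subset) auto
  ultimately obtain z where z: "z \<in> K - U" "\<And>x. x \<in> K - U \<Longrightarrow> h z \<le> h x"
    using continuous_attains_inf False by metis
  then have "0 < h z" using assms(4)[of z] by (auto simp: not_le[symmetric])
  with z(2) show thesis by (intro that[of "h z / 2"]) force+
qed

text \<open>Only \<open>y\<close> has to lie in \<open>X\<close>. A ball with radius enlarged by 1
  contains both points and is compact.\<close>

lemma uniform_continuity_near_bounded:
  fixes h :: "'a::euclidean_space \<Rightarrow> real"
  assumes "bounded X" and "continuous_on UNIV h" and "e > 0"
  obtains \<delta> where "\<delta> > 0" "\<And>x y. y \<in> X \<Longrightarrow> dist x y < \<delta> \<Longrightarrow> \<bar>h x - h y\<bar> < e"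
proof -
  obtain R where R: "\<And>y. y \<in> X \<Longrightarrow> norm y \<le> R" using assms(1) by (auto simp: bounded_iff)
  have "uniformly_continuous_on (cball 0 (R + 1)) h"
    by (rule compact_uniformly_continuous[OF continuous_on_subset[OF assms(2)]]) auto
  then obtain d where "d > 0" and d: "\<forall>x\<in>cball 0 (R + 1). \<forall>x'\<in>cball 0 (R + 1).
      dist x' x < d \<longrightarrow> dist (h x') (h x) < e"
    unfolding uniformly_continuous_on_def using \<open>e > 0\<close> by blast
  show thesis
  proof (rule that[of "min d 1"])
    fix x y assume xy: "y \<in> X" "dist x y < min d 1"
    have "norm x \<le> norm y + dist x y" by (simp add: dist_norm norm_triangle_sub)
    with xy R[OF xy(1)] have "x \<in> cball 0 (R + 1)" "y \<in> cball 0 (R + 1)" by auto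
    with d xy(2) have "dist (h x) (h y) < e" by simp
    then show "\<bar>h x - h y\<bar> < e" by (simp add: dist_real_def)
  qed (use \<open>d > 0\<close> in auto)
qed

lemma tube_close:
  assumes "x \<in> tube \<delta> X"
  obtains y where "y \<in> X" "dist x y < \<delta>"
proof -
  have "X \<noteq> {}" "infdist x X < \<delta>"
    using assms by (simp_all add: tube_def)
  then have "X \<noteq> {}" "(INF y\<in>X. dist x y) < \<delta>"
    by (simp_all add: infdist_notempty)
  moreover have "bdd_below (dist x ` X)" by (intro bdd_belowI2[where m = 0]) simp
  ultimately show thesis using that by (auto simp: cINF_less_iff)
qed

lemma open_tube: "open (tube \<epsilon> X)"
  by (cases "X = {}") (auto simp: tube_def intro!: open_Collect_less continuous_intros)

section \<open>Uniform Lyapunov decrease and divergence of the steps\<close>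

lemma p_d_LyapunovE:
  assumes "p_d_Lyapunov F p g U"
  obtains a \<omega> where "a > 0" "\<omega> > 0"
    "\<And>\<alpha> x u. 0 < \<alpha> \<Longrightarrow> \<alpha> \<le> a \<Longrightarrow> x \<in> U \<Longrightarrow> u \<in> F x \<Longrightarrow>
      g (x + \<alpha> *\<^sub>R u) - g x \<le> - \<omega> * \<alpha> powr p"
proof -
  from assms obtain a \<omega> where "a > 0" "\<omega> > 0"
    "\<forall>\<alpha>\<in>{0<..a}. \<forall>x\<in>U. \<forall>u\<in>F x. g (x + \<alpha> *\<^sub>R u) - g x \<le> - \<omega> * \<alpha> powr p"
    unfolding p_d_Lyapunov_def by blast
  then show thesis by (intro that[of a \<omega>]) auto
qed

lemma p_d_Lyapunov_Un:
  assumes "p_d_Lyapunov F p g A" "p_d_Lyapunov F p g B"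
  shows "p_d_Lyapunov F p g (A \<union> B)"
proof -
  obtain a \<omega> where A: "a > 0" "\<omega> > 0"
    "\<And>\<alpha> x u. 0 < \<alpha> \<Longrightarrow> \<alpha> \<le> a \<Longrightarrow> x \<in> A \<Longrightarrow> u \<in> F x \<Longrightarrow> g (x + \<alpha> *\<^sub>R u) - g x \<le> - \<omega> * \<alpha> powr p"
    by (rule p_d_LyapunovE[OF assms(1)]) (rule that)
  obtain b \<omega>' where B: "b > 0" "\<omega>' > 0"
    "\<And>\<alpha> x u. 0 < \<alpha> \<Longrightarrow> \<alpha> \<le> b \<Longrightarrow> x \<in> B \<Longrightarrow> u \<in> F x \<Longrightarrow> g (x + \<alpha> *\<^sub>R u) - g x \<le> - \<omega>' * \<alpha> powr p"
    by (rule p_d_LyapunovE[OF assms(2)]) (rule that)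
  show ?thesis
    unfolding p_d_Lyapunov_def
  proof (rule exI[of _ "min a b"], rule conjI, use A(1) B(1) in simp,
      rule exI[of _ "min \<omega> \<omega>'"], rule conjI, use A(2) B(2) in simp, intro ballI)
    fix \<alpha> x u assume *: "\<alpha> \<in> {0<..min a b}" "x \<in> A \<union> B" "u \<in> F x"
    have "min \<omega> \<omega>' * \<alpha> powr p \<le> \<omega> * \<alpha> powr p" "min \<omega> \<omega>' * \<alpha> powr p \<le> \<omega>' * \<alpha> powr p"
      by (intro mult_right_mono; simp)+
    moreover have "g (x + \<alpha> *\<^sub>R u) - g x \<le> - \<omega> * \<alpha> powr p \<or> g (x + \<alpha> *\<^sub>R u) - g x \<le> - \<omega>' * \<alpha> powr p"
      using * A(3)[of \<alpha> x u] B(3)[of \<alpha> x u] by auto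
    ultimately show "g (x + \<alpha> *\<^sub>R u) - g x \<le> - min \<omega> \<omega>' * \<alpha> powr p"
      by auto
  qed
qed

text \<open>The constants of the property can be minimised over finitely many sets, so a finite
  subcover gives a single step bound and a single rate.\<close>

lemma p_d_Lyapunov_compact:
  assumes "compact Q" and "\<And>x. x \<in> Q \<Longrightarrow> \<exists>U. open U \<and> x \<in> U \<and> p_d_Lyapunov F p g U"
  obtains U where "open U" "Q \<subseteq> U" "p_d_Lyapunov F p g U"
proof -
  obtain U where U: "\<And>x. x \<in> Q \<Longrightarrow> open (U x) \<and> x \<in> U x \<and> p_d_Lyapunov F p g (U x)"
    using assms(2) by metis
  have "Q \<subseteq> (\<Union>x\<in>Q. U x)" using U by blast
  then obtain C where C: "C \<subseteq> Q" "finite C" "Q \<subseteq> (\<Union>x\<in>C. U x)"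
    by (rule compactE_image[OF assms(1), rotated]) (use U in auto)
  have "p_d_Lyapunov F p g (\<Union>x\<in>C. U x)"
    using C(2,1)
  proof (induction rule: finite_induct)
    case empty
    show ?case by (auto simp: p_d_Lyapunov_def intro: exI[of _ "1::real"])
  next
    case (insert c C)
    then have "p_d_Lyapunov F p g (U c \<union> (\<Union>x\<in>C. U x))" using U by (intro p_d_Lyapunov_Un) auto
    then show ?case by simp
  qed
  then show thesis using that[of "\<Union>x\<in>C. U x"] C U by blast
qed

lemma p_divergent_not_summable: "p_divergent p \<alpha> \<Longrightarrow> \<not> summable (\<lambda>k. \<alpha> k powr p)"
  by (auto simp: p_divergent_def suminf_ennreal2)

text \<open>Links the clock of \<open>g\<close> to that of \<open>f\<close>:
  \<open>\<alpha> k powr p \<le> \<alpha> k\<close> for steps at most 1.\<close>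

lemma not_summable_if_powr_not_summable:
  fixes \<alpha> :: "nat \<Rightarrow> real"
  assumes "\<not> summable (\<lambda>k. \<alpha> k powr p)" and "\<And>k. 0 < \<alpha> k" "\<And>k. \<alpha> k \<le> 1" and "1 \<le> p"
  shows "\<not> summable \<alpha>"
proof
  assume "summable \<alpha>"
  moreover have "norm (\<alpha> k powr p) \<le> \<alpha> k" for k
    using assms(2,3)[of k] \<open>1 \<le> p\<close> powr_mono'[of 1 p "\<alpha> k"] by simp
  ultimately show False using assms(1) by (metis summable_comparison_test')
qed

section \<open>Joint control of the potential and the Lyapunov function\<close>

locale euler_lyapunov = euler_descent F D f
  for F D :: "'a::euclidean_space \<Rightarrow> 'a set" and f :: "'a \<Rightarrow> real" +
  fixes g :: "'a \<Rightarrow> real" and p lbar :: real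
  assumes f_nonneg: "0 \<le> f x"
    and f_zero: "\<exists>x. f x = 0"
    and lbar: "0 < lbar"
    and noncritical: "0 < f x \<Longrightarrow> f x < lbar \<Longrightarrow> 0 \<notin> D x"
    and p: "1 \<le> p"
    and continuous_g: "continuous_on UNIV g"
    and g_nonneg: "0 \<le> g x"
    and Lyapunov: "f x = 0 \<Longrightarrow> 0 < g x \<Longrightarrow> \<exists>U. open U \<and> x \<in> U \<and> p_d_Lyapunov F p g U"
    and coercive: "coercive (\<lambda>x. f x + g x)"
begin

text \<open>A priori this set might be empty and differ from the minimisers of \<open>f + g\<close>;
  the two are identified once a common zero has been found.\<close>

definition zeros :: "'a set" where "zeros = {x. f x = 0 \<and> g x = 0}"

lemma compact_sublevel: "compact {x. f x + g x \<le> C}"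
proof -
  have "closed {x. f x + g x \<le> C}"
    by (intro closed_Collect_le continuous_intros continuous_f continuous_g)
  moreover have "\<forall>\<^sub>F x in at_infinity. C < f x + g x"
    using coercive by (simp add: coercive_def filterlim_at_top_dense)
  then have "bounded {x. f x + g x \<le> C}"
    unfolding eventually_at_infinity bounded_iff by (metis linorder_not_le mem_Collect_eq nle_le)
  ultimately show ?thesis by (simp add: compact_eq_bounded_closed)
qed

lemma compact_sublevel_Int:
  "compact ({x. f x + g x \<le> C} \<inter> {x. f x \<le> a} \<inter> {x. b \<le> g x})"
  by (intro compact_Int_closed compact_sublevel closed_Collect_le continuous_on_const
    continuous_f continuous_g)

lemma small_step:
  fixes h :: "'a \<Rightarrow> real"
  assumes "compact K" and "continuous_on UNIV h" and "e > 0"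
  obtains a where "a > 0"
    "\<And>\<alpha> x u. 0 < \<alpha> \<Longrightarrow> \<alpha> \<le> a \<Longrightarrow> x \<in> K \<Longrightarrow> u \<in> F x \<Longrightarrow> \<bar>h (x + \<alpha> *\<^sub>R u) - h x\<bar> < e"
proof -
  obtain M where M: "M > 0" "\<And>x u. x \<in> K \<Longrightarrow> u \<in> F x \<Longrightarrow> norm u \<le> M"
    using usc_bounded_on_compact[OF usc F_values(2) assms(1)] by metis
  obtain d where d: "d > 0" "\<And>x y. y \<in> K \<Longrightarrow> dist x y < d \<Longrightarrow> \<bar>h x - h y\<bar> < e"
    using uniform_continuity_near_bounded[OF compact_imp_bounded[OF assms(1)] assms(2,3)] by metis
  show thesis
  proof (rule that[of "d / (2 * M)"])
    fix \<alpha> x u assume *: "0 < \<alpha>" "\<alpha> \<le> d / (2 * M)" "x \<in> K" "u \<in> F x"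
    have "dist (x + \<alpha> *\<^sub>R u) x = \<alpha> * norm u" using *(1) by (simp add: dist_norm)
    also have "\<dots> \<le> d / (2 * M) * M" using * M d(1) by (intro mult_mono) auto
    also have "\<dots> < d" using d(1) M(1) by simp
    finally show "\<bar>h (x + \<alpha> *\<^sub>R u) - h x\<bar> < e" using d(2) *(3) by blast
  qed (use d M in auto)
qed

text \<open>For small \<open>f\<close>, each step decreases \<open>g\<close> as long as \<open>g \<ge> \<eta>\<close>, and a step from \<open>g \<le> \<eta>\<close> cannot
  jump above \<open>2 * \<eta>\<close>; the control of \<open>g\<close> and the coercivity keep the sequence in a compact set,
  where \<open>f\<close> stays small.\<close>

lemma trapping:
  assumes "0 < \<eta>" "2 * \<eta> \<le> C"
  obtains l0 where "0 < l0"
    "\<And>l. 0 < l \<Longrightarrow> l \<le> l0 \<Longrightarrow> \<exists>\<alpha>bar>0. \<forall>\<alpha> x. range \<alpha> \<subseteq> {0<..\<alpha>bar} \<and> euler_sequence F \<alpha> x \<and>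
      f (x 0) \<le> l / 2 \<and> g (x 0) \<le> C \<longrightarrow>
      (\<forall>k. f (x k) \<le> l \<and> g (x k) \<le> C) \<and>
      (\<not> summable (\<lambda>k. \<alpha> k powr p) \<longrightarrow> (\<exists>k0. \<forall>k\<ge>k0. g (x k) \<le> 2 * \<eta>))"
proof -
  let ?Q = "{x. f x + g x \<le> C + 1} \<inter> {x. f x \<le> 0} \<inter> {x. \<eta> \<le> g x}"
  obtain U where U: "open U" "?Q \<subseteq> U" "p_d_Lyapunov F p g U"
  proof (rule p_d_Lyapunov_compact[OF compact_sublevel_Int])
    fix x assume "x \<in> ?Q"
    then show "\<exists>U. open U \<and> x \<in> U \<and> p_d_Lyapunov F p g U"
      using f_nonneg[of x] \<open>0 < \<eta>\<close> by (intro Lyapunov) auto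
  qed
  \<comment> \<open>\<open>U\<close> is only known to cover points with \<open>f = 0\<close>;
    \<open>m\<close> extends the decrease of \<open>g\<close> to small positive
    \<open>f\<close>.\<close>
  obtain m where m: "m > 0"
    "\<And>x. x \<in> {x. f x + g x \<le> C + 1} \<inter> {x. f x \<le> 1} \<inter> {x. \<eta> \<le> g x} \<Longrightarrow> f x \<le> m \<Longrightarrow> x \<in> U"
    by (rule sublevel_subset_open[OF compact_sublevel_Int[of "C + 1" 1 \<eta>]
          continuous_on_subset[OF continuous_f] U(1)]) (use U(2) in auto)
  obtain a1 \<omega> where a1: "a1 > 0" and "\<omega> > 0"
    and lyap: "\<And>\<alpha> x u. 0 < \<alpha> \<Longrightarrow> \<alpha> \<le> a1 \<Longrightarrow> x \<in> U \<Longrightarrow> u \<in> F x \<Longrightarrow>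
      g (x + \<alpha> *\<^sub>R u) - g x \<le> - \<omega> * \<alpha> powr p"
    by (rule p_d_LyapunovE[OF U(3)]) (rule that)
  obtain a2 where a2: "a2 > 0" "\<And>\<alpha> x u. 0 < \<alpha> \<Longrightarrow> \<alpha> \<le> a2 \<Longrightarrow> x \<in> {x. f x + g x \<le> C + 1} \<Longrightarrow>
      u \<in> F x \<Longrightarrow> \<bar>f (x + \<alpha> *\<^sub>R u) - f x\<bar> < 1"
    by (rule small_step[OF compact_sublevel[of "C + 1"] continuous_f zero_less_one]) blast
  obtain a3 where a3: "a3 > 0" "\<And>\<alpha> x u. 0 < \<alpha> \<Longrightarrow> \<alpha> \<le> a3 \<Longrightarrow> x \<in> {x. f x + g x \<le> C + 1} \<Longrightarrow>
      u \<in> F x \<Longrightarrow> \<bar>g (x + \<alpha> *\<^sub>R u) - g x\<bar> < \<eta>"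
    by (rule small_step[OF compact_sublevel[of "C + 1"] continuous_g \<open>0 < \<eta>\<close>]) blast
  show thesis
  proof (rule that[of "min (min m 1) (lbar / 2)"])
    fix l assume l: "0 < l" "l \<le> min (min m 1) (lbar / 2)"
    \<comment> \<open>The next iterate must lie in a compact set before its \<open>f\<close> can be
      bounded by \<open>l\<close>. Now \<open>f \<le> l \<le> 1\<close> before the step, the step
      adds at most 1, and \<open>g \<le> C\<close> after it, hence the level
      \<open>C + 2\<close>.\<close>
    obtain a4 where a4: "a4 > 0"
      "\<And>\<alpha> x k. range \<alpha> \<subseteq> {0<..a4} \<Longrightarrow> euler_sequence F \<alpha> x \<Longrightarrow> f (x 0) \<le> l / 2 \<Longrightarrow>
        (\<And>i. i \<le> k \<Longrightarrow> x i \<in> {x. f x + g x \<le> C + 2}) \<Longrightarrow> f (x k) \<le> l"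
      by (rule stays_below[OF compact_sublevel[of "C + 2"] l(1), of lbar])
        (use l lbar noncritical in auto)
    define \<alpha>bar where "\<alpha>bar = min (min a1 a2) (min a3 a4)"
    have "0 < \<alpha>bar" using a1 a2 a3 a4 by (simp add: \<alpha>bar_def)
    moreover have "(\<forall>k. f (x k) \<le> l \<and> g (x k) \<le> C) \<and>
      (\<not> summable (\<lambda>k. \<alpha> k powr p) \<longrightarrow> (\<exists>k0. \<forall>k\<ge>k0. g (x k) \<le> 2 * \<eta>))"
      if \<alpha>: "range \<alpha> \<subseteq> {0<..\<alpha>bar}" and euler: "euler_sequence F \<alpha> x"
        and x0: "f (x 0) \<le> l / 2" "g (x 0) \<le> C" for \<alpha> x
    proof (intro conjI allI impI)
      have \<alpha>k: "0 < \<alpha> k" "\<alpha> k \<le> \<alpha>bar" for k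
        using \<alpha> by (meson greaterThanAtMost_iff range_subsetD)+
      have \<alpha>_a4: "range \<alpha> \<subseteq> {0<..a4}"
        using \<alpha>k by (auto simp: \<alpha>bar_def)
      have step: "(\<eta> \<le> g (x k) \<longrightarrow> g (x (Suc k)) \<le> g (x k) - \<omega> * \<alpha> k powr p) \<and>
          (g (x k) \<le> \<eta> \<longrightarrow> g (x (Suc k)) \<le> 2 * \<eta>) \<and> f (x (Suc k)) \<le> f (x k) + 1"
        if xk: "f (x k) \<le> l" "g (x k) \<le> C" for k
      proof -
        obtain u where u: "u \<in> F (x k)" "x (Suc k) = x k + \<alpha> k *\<^sub>R u"
          using euler by (auto simp: euler_sequence_def)
        have C1: "f (x k) + g (x k) \<le> C + 1" using xk l by simp
        have "\<eta> \<le> g (x k) \<Longrightarrow> x k \<in> U" using C1 xk l by (intro m) auto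
        then show ?thesis
          using lyap[OF \<alpha>k(1), of k "x k" u] a2(2)[OF \<alpha>k(1), of k "x k" u]
            a3(2)[OF \<alpha>k(1), of k "x k" u] \<alpha>k(2)[of k] u C1
          by (auto simp: \<alpha>bar_def)
      qed
      have inv: "\<forall>i\<le>k. f (x i) \<le> l \<and> g (x i) \<le> C" for k
      proof (induction k)
        case 0
        then show ?case using x0 l by simp
      next
        case (Suc k)
        then have xk: "f (x k) \<le> l" "g (x k) \<le> C" by auto
        have "0 \<le> \<omega> * \<alpha> k powr p" using \<open>\<omega> > 0\<close> by simp
        then have "g (x (Suc k)) \<le> C" using step[OF xk] xk \<open>2 * \<eta> \<le> C\<close> by linarith
        moreover have "f (x (Suc k)) \<le> l"
        proof (rule a4(2)[OF \<alpha>_a4 euler x0(1)])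
          fix i assume "i \<le> Suc k"
          then consider "i \<le> k" | "i = Suc k" by linarith
          then show "x i \<in> {x. f x + g x \<le> C + 2}"
            using Suc.IH step[OF xk] xk l \<open>g (x (Suc k)) \<le> C\<close> by cases force+
        qed
        ultimately show ?case using Suc.IH by (auto simp: le_Suc_eq)
      qed
      then show "f (x k) \<le> l" "g (x k) \<le> C" for k by blast+
      have g_step: "\<eta> \<le> g (x k) \<Longrightarrow> g (x (Suc k)) \<le> g (x k) - \<omega> * \<alpha> k powr p"
        "g (x k) \<le> \<eta> \<Longrightarrow> g (x (Suc k)) \<le> 2 * \<eta>" for k
        using step inv by blast+
      assume divergent: "\<not> summable (\<lambda>k. \<alpha> k powr p)"
      \<comment> \<open>Otherwise every step would lower \<open>g\<close> by \<open>\<omega>\<close>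
        times its \<open>p\<close>-th power, and nonnegativity of \<open>g\<close> would bound the
        series.\<close>
      have "\<exists>k0. g (x k0) \<le> \<eta>"
      proof (rule ccontr)
        assume "\<nexists>k0. g (x k0) \<le> \<eta>"
        then have "\<eta> \<le> g (x k)" for k by (meson linear)
        have "g (x n) \<le> C - \<omega> * (\<Sum>k<n. \<alpha> k powr p)" for n
        proof (induction n)
          case (Suc n)
          then show ?case using g_step(1)[OF \<open>\<And>k. \<eta> \<le> g (x k)\<close>, of n] by (simp add: distrib_left)
        qed (use x0 in simp)
        then have "\<omega> * (\<Sum>k<n. \<alpha> k powr p) \<le> C" for n using g_nonneg[of "x n"] by (smt (verit))
        then have "(\<Sum>k<n. \<alpha> k powr p) \<le> C / \<omega>" for n
          using \<open>\<omega> > 0\<close> by (simp add: field_simps)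
        then have "summable (\<lambda>k. \<alpha> k powr p)" by (intro summableI_nonneg_bounded) auto
        with divergent show False by simp
      qed
      then obtain k0 where k0: "g (x k0) \<le> \<eta>" by blast
      have "g (x k) \<le> 2 * \<eta>" if "k \<ge> k0" for k
        using that
      proof (induction k rule: dec_induct)
        case base
        then show ?case using k0 \<open>0 < \<eta>\<close> by simp
      next
        case (step k)
        have "0 \<le> \<omega> * \<alpha> k powr p" using \<open>\<omega> > 0\<close> by simp
        then show ?case
          using step.IH g_step[of k] by linarith
      qed
      then show "\<exists>k0. \<forall>k\<ge>k0. g (x k) \<le> 2 * \<eta>" by blast
    qed
    ultimately show "\<exists>\<alpha>bar>0. \<forall>\<alpha> x. range \<alpha> \<subseteq> {0<..\<alpha>bar} \<and> euler_sequence F \<alpha> x \<and>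
      f (x 0) \<le> l / 2 \<and> g (x 0) \<le> C \<longrightarrow>
      (\<forall>k. f (x k) \<le> l \<and> g (x k) \<le> C) \<and>
      (\<not> summable (\<lambda>k. \<alpha> k powr p) \<longrightarrow> (\<exists>k0. \<forall>k\<ge>k0. g (x k) \<le> 2 * \<eta>))"
      by blast
  qed (use m lbar in auto)
qed

text \<open>The target is split evenly: \<open>l \<le> m / 2\<close> for \<open>f\<close> and
  \<open>2 * \<eta> \<le> m / 2\<close> for \<open>g\<close>. No common zero is presupposed, so the
  result can also serve to produce one.\<close>

lemma sublevel_attraction:
  assumes m: "m > 0" and "C > 0" "L > 0"
  obtains l a where "0 < l" "l \<le> L" "0 < a"
    "\<And>\<alpha> x. range \<alpha> \<subseteq> {0<..a} \<Longrightarrow> euler_sequence F \<alpha> x \<Longrightarrow> f (x 0) \<le> l / 2 \<Longrightarrow> g (x 0) \<le> C \<Longrightarrow>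
      (\<forall>k. f (x k) \<le> l \<and> g (x k) \<le> C) \<and>
      (\<not> summable (\<lambda>k. \<alpha> k powr p) \<longrightarrow> (\<exists>k0. \<forall>k\<ge>k0. f (x k) + g (x k) \<le> m))"
proof -
  define \<eta> where "\<eta> = min (m / 4) (C / 2)"
  have \<eta>: "0 < \<eta>" "2 * \<eta> \<le> C" "2 * \<eta> \<le> m / 2" using m \<open>C > 0\<close> by (auto simp: \<eta>_def)
  obtain l0 where l0: "0 < l0"
    "\<And>l. 0 < l \<Longrightarrow> l \<le> l0 \<Longrightarrow> \<exists>\<alpha>bar>0. \<forall>\<alpha> x. range \<alpha> \<subseteq> {0<..\<alpha>bar} \<and> euler_sequence F \<alpha> x \<and>
      f (x 0) \<le> l / 2 \<and> g (x 0) \<le> C \<longrightarrow>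
      (\<forall>k. f (x k) \<le> l \<and> g (x k) \<le> C) \<and>
      (\<not> summable (\<lambda>k. \<alpha> k powr p) \<longrightarrow> (\<exists>k0. \<forall>k\<ge>k0. g (x k) \<le> 2 * \<eta>))"
    using trapping[OF \<eta>(1,2)] by blast
  define l where "l = min (min l0 L) (m / 2)"
  have l: "0 < l" "l \<le> l0" "l \<le> L" "l \<le> m / 2" using l0 m \<open>L > 0\<close> by (auto simp: l_def)
  obtain a where a: "a > 0" and trap: "\<And>\<alpha> x. range \<alpha> \<subseteq> {0<..a} \<and> euler_sequence F \<alpha> x \<and>
      f (x 0) \<le> l / 2 \<and> g (x 0) \<le> C \<Longrightarrow>
      (\<forall>k. f (x k) \<le> l \<and> g (x k) \<le> C) \<and>
      (\<not> summable (\<lambda>k. \<alpha> k powr p) \<longrightarrow> (\<exists>k0. \<forall>k\<ge>k0. g (x k) \<le> 2 * \<eta>))"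
    using l0(2)[OF l(1,2)] by blast
  show thesis
  proof (rule that[OF l(1,3) a])
    fix \<alpha> x
    assume *: "range \<alpha> \<subseteq> {0<..a}" "euler_sequence F \<alpha> x" "f (x 0) \<le> l / 2" "g (x 0) \<le> C"
    have trapped: "(\<forall>k. f (x k) \<le> l \<and> g (x k) \<le> C) \<and>
      (\<not> summable (\<lambda>k. \<alpha> k powr p) \<longrightarrow> (\<exists>k0. \<forall>k\<ge>k0. g (x k) \<le> 2 * \<eta>))"
      using * by (intro trap) simp
    have "f (x k) + g (x k) \<le> m" if "g (x k) \<le> 2 * \<eta>" for k
    proof -
      have "f (x k) \<le> l" using trapped by blast
      with that \<eta>(3) l(4) show "f (x k) + g (x k) \<le> m" by simp
    qed
    with trapped show "(\<forall>k. f (x k) \<le> l \<and> g (x k) \<le> C) \<and>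
      (\<not> summable (\<lambda>k. \<alpha> k powr p) \<longrightarrow> (\<exists>k0. \<forall>k\<ge>k0. f (x k) + g (x k) \<le> m))"
      by blast
  qed
qed

lemma euler_sequence_exists:
  assumes "a > 0"
  obtains x where "x 0 = z" "euler_sequence F (\<lambda>_. a) x"
proof -
  define x where "x = rec_nat z (\<lambda>_ y. y + a *\<^sub>R (SOME u. u \<in> F y))"
  have "x 0 = z" "x (Suc k) = x k + a *\<^sub>R (SOME u. u \<in> F (x k))" for k
    by (simp_all add: x_def)
  moreover have "(SOME u. u \<in> F y) \<in> F y" for y
    using F_values(1) by (simp add: some_in_eq)
  ultimately show thesis
    using that[of x] \<open>a > 0\<close> by (auto simp: euler_sequence_def)
qed

text \<open>Existence of a common zero: an Euler sequence with constant steps started at a zero of \<open>f\<close>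
  reaches points of a fixed compact set at which \<open>f + g\<close> is arbitrarily small.\<close>

lemma zeros_nonempty: "zeros \<noteq> {}"
proof
  assume "zeros = {}"
  obtain z where z: "f z = 0" using f_zero by blast
  define C where "C = g z + 1"
  have "C > 0" using g_nonneg[of z] by (simp add: C_def)
  have pos: "\<not> f x + g x \<le> 0" for x
  proof
    assume "f x + g x \<le> 0"
    then have "x \<in> zeros" using f_nonneg[of x] g_nonneg[of x] by (simp add: zeros_def)
    with \<open>zeros = {}\<close> show False by simp
  qed
  have "continuous_on {x. f x + g x \<le> C + 1} (\<lambda>x. f x + g x)"
    by (intro continuous_on_add continuous_on_subset[OF continuous_f]
      continuous_on_subset[OF continuous_g]) auto
  \<comment> \<open>With the empty set as open set, \<open>m\<close> is a strict lower bound of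
    \<open>f + g\<close> on the compact sublevel set.\<close>
  then obtain m where m: "m > 0" "\<And>x. f x + g x \<le> C + 1 \<Longrightarrow> f x + g x \<le> m \<Longrightarrow> x \<in> {}"
    by (rule sublevel_subset_open[OF compact_sublevel[of "C + 1"] _ open_empty])
      (use pos in auto)
  obtain l a where la: "0 < l" "l \<le> 1" "0 < a"
    and trap: "\<And>\<alpha> x. range \<alpha> \<subseteq> {0<..a} \<Longrightarrow> euler_sequence F \<alpha> x \<Longrightarrow> f (x 0) \<le> l / 2 \<Longrightarrow> g (x 0) \<le> C \<Longrightarrow>
      (\<forall>k. f (x k) \<le> l \<and> g (x k) \<le> C) \<and>
      (\<not> summable (\<lambda>k. \<alpha> k powr p) \<longrightarrow> (\<exists>k0. \<forall>k\<ge>k0. f (x k) + g (x k) \<le> m))"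
    by (rule sublevel_attraction[OF m(1) \<open>C > 0\<close> zero_less_one]) (rule that)
  obtain x where x: "x 0 = z" "euler_sequence F (\<lambda>_. a) x"
    using euler_sequence_exists[OF la(3)] by blast
  have "\<not> summable (\<lambda>_::nat. a powr p)" using la(3) by (simp add: summable_const_iff)
  moreover have "range (\<lambda>_. a) \<subseteq> {0<..a}" "f (x 0) \<le> l / 2" "g (x 0) \<le> C"
    using la x z by (auto simp: C_def)
  note trap[OF this(1) x(2) this(2,3)]
  ultimately obtain k where "f (x k) + g (x k) \<le> m" "f (x k) \<le> l" "g (x k) \<le> C"
    by blast
  then show False using m(2)[of "x k"] la(2) by simp
qed

text \<open>Coercivity turns smallness of \<open>f + g\<close> into closeness to the zeros: sublevel
  sets are compact, and capping \<open>m\<close> by 1 places every such point in one of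
  them.\<close>

lemma zeros_near:
  assumes "\<epsilon> > 0"
  obtains m where "m > 0" "\<And>x. f x + g x \<le> m \<Longrightarrow> x \<in> tube \<epsilon> zeros"
proof -
  have "continuous_on {x. f x + g x \<le> 1} (\<lambda>x. f x + g x)"
    by (intro continuous_on_add continuous_on_subset[OF continuous_f]
      continuous_on_subset[OF continuous_g]) auto
  then obtain m where m: "m > 0" "\<And>x. x \<in> {x. f x + g x \<le> 1} \<Longrightarrow> f x + g x \<le> m \<Longrightarrow> x \<in> tube \<epsilon> zeros"
  proof (rule sublevel_subset_open[OF compact_sublevel[of 1] _ open_tube])
    fix x assume "f x + g x \<le> 0"
    then have "x \<in> zeros" using f_nonneg[of x] g_nonneg[of x] by (simp add: zeros_def)
    then show "x \<in> tube \<epsilon> zeros" using \<open>\<epsilon> > 0\<close> by (auto simp: tube_def)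
  qed blast
  show thesis by (rule that[of "min m 1"]) (use m in auto)
qed

lemma bounded_zeros: "bounded zeros"
  by (rule bounded_subset[OF compact_imp_bounded[OF compact_sublevel[of 0]]]) (auto simp: zeros_def)

lemma arg_min_set_eq_zeros: "arg_min_set (\<lambda>x. f x + g x) = zeros"
proof -
  obtain z where z: "f z = 0" "g z = 0" using zeros_nonempty by (auto simp: zeros_def)
  have "x \<in> arg_min_set (\<lambda>x. f x + g x) \<longleftrightarrow> x \<in> zeros" for x
  proof
    assume "x \<in> arg_min_set (\<lambda>x. f x + g x)"
    then have "\<not> f z + g z < f x + g x" by (simp add: arg_min_set_def is_arg_min_def)
    then show "x \<in> zeros" using z f_nonneg[of x] g_nonneg[of x] by (simp add: zeros_def)
  next
    assume "x \<in> zeros"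
    then show "x \<in> arg_min_set (\<lambda>x. f x + g x)"
      by (auto simp: arg_min_set_def is_arg_min_def zeros_def not_less f_nonneg g_nonneg)
  qed
  then show ?thesis by blast
qed

lemma attraction:
  assumes "\<epsilon> > 0" "C > 0" "L > 0"
  obtains l a where "0 < l" "l \<le> L" "0 < a"
    "\<And>\<alpha> x. range \<alpha> \<subseteq> {0<..a} \<Longrightarrow> euler_sequence F \<alpha> x \<Longrightarrow> f (x 0) \<le> l / 2 \<Longrightarrow> g (x 0) \<le> C \<Longrightarrow>
      (\<forall>k. f (x k) \<le> l \<and> g (x k) \<le> C) \<and>
      (\<not> summable (\<lambda>k. \<alpha> k powr p) \<longrightarrow> (\<exists>k0. \<forall>k\<ge>k0. x k \<in> tube \<epsilon> zeros))"
proof -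
  obtain m where m: "m > 0" "\<And>x. f x + g x \<le> m \<Longrightarrow> x \<in> tube \<epsilon> zeros"
    using zeros_near[OF \<open>\<epsilon> > 0\<close>] by blast
  show thesis
  proof (rule sublevel_attraction[OF m(1) assms(2,3)], rule that)
    fix l a \<alpha> x
    assume trap: "\<And>\<alpha> x. range \<alpha> \<subseteq> {0<..a} \<Longrightarrow> euler_sequence F \<alpha> x \<Longrightarrow> f (x 0) \<le> l / 2 \<Longrightarrow> g (x 0) \<le> C \<Longrightarrow>
      (\<forall>k. f (x k) \<le> l \<and> g (x k) \<le> C) \<and>
      (\<not> summable (\<lambda>k. \<alpha> k powr p) \<longrightarrow> (\<exists>k0. \<forall>k\<ge>k0. f (x k) + g (x k) \<le> m))"
      and *: "range \<alpha> \<subseteq> {0<..a}" "euler_sequence F \<alpha> x" "f (x 0) \<le> l / 2" "g (x 0) \<le> C"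
    from trap[OF *] show "(\<forall>k. f (x k) \<le> l \<and> g (x k) \<le> C) \<and>
      (\<not> summable (\<lambda>k. \<alpha> k powr p) \<longrightarrow> (\<exists>k0. \<forall>k\<ge>k0. x k \<in> tube \<epsilon> zeros))"
      using m(2) by blast
  qed
qed

section \<open>Stability and attraction of the common zeros\<close>

lemma tube_values:
  assumes "bounded X" and "X \<subseteq> {x. f x = 0}" and B: "\<And>y. y \<in> X \<Longrightarrow> g y \<le> B" and "0 < e"
  obtains \<delta> where "\<delta> > 0" "\<And>x. x \<in> tube \<delta> X \<Longrightarrow> f x \<le> e \<and> g x \<le> B + e"
proof -
  obtain d1 where d1: "d1 > 0" "\<And>x y. y \<in> X \<Longrightarrow> dist x y < d1 \<Longrightarrow> \<bar>f x - f y\<bar> < e"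
    using uniform_continuity_near_bounded[OF assms(1) continuous_f \<open>0 < e\<close>] by blast
  obtain d2 where d2: "d2 > 0" "\<And>x y. y \<in> X \<Longrightarrow> dist x y < d2 \<Longrightarrow> \<bar>g x - g y\<bar> < e"
    using uniform_continuity_near_bounded[OF assms(1) continuous_g \<open>0 < e\<close>] by blast
  show thesis
  proof (rule that[of "min d1 d2"])
    fix x assume "x \<in> tube (min d1 d2) X"
    then obtain y where y: "y \<in> X" "dist x y < min d1 d2" by (rule tube_close)
    have "\<bar>f x - f y\<bar> < e" using y by (intro d1(2)) auto
    moreover have "\<bar>g x - g y\<bar> < e" using y by (intro d2(2)) auto
    moreover have "f y = 0" using y(1) assms(2) by auto
    ultimately show "f x \<le> e \<and> g x \<le> B + e" using B[OF y(1)] by linarith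
  qed (use d1 d2 in auto)
qed

lemma tube_zeros_values:
  assumes "0 < e"
  obtains \<delta> where "\<delta> > 0" "\<And>x. x \<in> tube \<delta> zeros \<Longrightarrow> f x \<le> e \<and> g x \<le> e"
  by (rule tube_values[of zeros 0, OF bounded_zeros _ _ assms]) (auto simp: zeros_def intro: that)

text \<open>Stability follows from the invariant half of \<open>attraction\<close>, valid for all
  small steps: \<open>f\<close> and \<open>g\<close> each stay below half of a level whose sublevel
  set lies in the tube.\<close>

lemma d_stable_zeros: "d_stable F zeros"
  unfolding d_stable_def
proof (intro allI impI)
  fix \<epsilon> :: real assume "\<epsilon> > 0"
  obtain m where m: "m > 0" "\<And>x. f x + g x \<le> m \<Longrightarrow> x \<in> tube \<epsilon> zeros"
    using zeros_near[OF \<open>\<epsilon> > 0\<close>] by blast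
  then have "m / 2 > 0" by simp
  obtain l a where la: "0 < l" "l \<le> m / 2" "0 < a"
    and trap: "\<And>\<alpha> x. range \<alpha> \<subseteq> {0<..a} \<Longrightarrow> euler_sequence F \<alpha> x \<Longrightarrow> f (x 0) \<le> l / 2 \<Longrightarrow> g (x 0) \<le> m / 2 \<Longrightarrow>
      (\<forall>k. f (x k) \<le> l \<and> g (x k) \<le> m / 2) \<and>
      (\<not> summable (\<lambda>k. \<alpha> k powr p) \<longrightarrow> (\<exists>k0. \<forall>k\<ge>k0. x k \<in> tube \<epsilon> zeros))"
    by (rule attraction[OF \<open>\<epsilon> > 0\<close> \<open>m / 2 > 0\<close> \<open>m / 2 > 0\<close>]) (rule that)
  have "0 < l / 2" using la by simp
  then obtain \<delta> where \<delta>: "\<delta> > 0" "\<And>x. x \<in> tube \<delta> zeros \<Longrightarrow> f x \<le> l / 2 \<and> g x \<le> l / 2"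
    using tube_zeros_values by blast
  show "\<exists>\<delta>>0. \<exists>\<alpha>bar>0. \<forall>\<alpha> x.
      range \<alpha> \<subseteq> {0<..\<alpha>bar} \<and> euler_sequence F \<alpha> x \<and> x 0 \<in> tube \<delta> zeros
      \<longrightarrow> range x \<subseteq> tube \<epsilon> zeros"
  proof (rule exI[of _ \<delta>], rule conjI[OF \<delta>(1)], rule exI[of _ a], rule conjI[OF la(3)],
      intro allI impI, elim conjE)
    fix \<alpha> x
    assume *: "range \<alpha> \<subseteq> {0<..a}" "euler_sequence F \<alpha> x" "x 0 \<in> tube \<delta> zeros"
    have "f (x k) \<le> l \<and> g (x k) \<le> m / 2" for k
      using trap[OF *(1,2)] \<delta>(2)[OF *(3)] la by auto
    then have "f (x k) + g (x k) \<le> m" for k using la(2) by (smt (verit) field_sum_of_halves)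
    then show "range x \<subseteq> tube \<epsilon> zeros" using m(2) by blast
  qed
qed

lemma p_attractor_zeros: "p_attractor F f p zeros"
  unfolding p_attractor_def
proof (intro conjI allI impI)
  show "bounded zeros" by (rule bounded_zeros)
  show "zeros \<subseteq> {x. f x = 0}" by (auto simp: zeros_def)
  fix \<epsilon> L :: real and X :: "'a set"
  assume "\<epsilon> > 0" "L > 0" and X: "bounded X \<and> X \<subseteq> {x. f x = 0}"
  have "compact (g ` closure X)"
    using X by (intro compact_continuous_image continuous_on_subset[OF continuous_g]) auto
  then obtain B where B: "\<And>y. y \<in> closure X \<Longrightarrow> norm (g y) \<le> B"
    using compact_imp_bounded[of "g ` closure X"] by (auto simp: bounded_iff)
  \<comment> \<open>The maximum with 0 keeps \<open>C\<close> positive even for empty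
    \<open>X\<close>; the added 1 covers the variation of \<open>g\<close> between \<open>X\<close>
    and its tube.\<close>
  define C where "C = max B 0 + 1"
  have "C > 0" by (simp add: C_def)
  obtain l a where la: "0 < l" "l \<le> L" "0 < a"
    and trap: "\<And>\<alpha> x. range \<alpha> \<subseteq> {0<..a} \<Longrightarrow> euler_sequence F \<alpha> x \<Longrightarrow> f (x 0) \<le> l / 2 \<Longrightarrow> g (x 0) \<le> C \<Longrightarrow>
      (\<forall>k. f (x k) \<le> l \<and> g (x k) \<le> C) \<and>
      (\<not> summable (\<lambda>k. \<alpha> k powr p) \<longrightarrow> (\<exists>k0. \<forall>k\<ge>k0. x k \<in> tube \<epsilon> zeros))"
    by (rule attraction[OF \<open>\<epsilon> > 0\<close> \<open>C > 0\<close> \<open>L > 0\<close>]) (rule that)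
  have "0 < min (l / 2) 1" using la by simp
  moreover have "g y \<le> max B 0" if "y \<in> X" for y
    using B[of y] that closure_subset by fastforce
  ultimately obtain \<delta> where \<delta>: "\<delta> > 0"
    "\<And>x. x \<in> tube \<delta> X \<Longrightarrow> f x \<le> min (l / 2) 1 \<and> g x \<le> max B 0 + min (l / 2) 1"
    using tube_values[of X "max B 0" "min (l / 2) 1"] X by blast
  show "\<exists>\<delta>>0. \<exists>\<alpha>bar>0. \<forall>\<alpha> x.
        range \<alpha> \<subseteq> {0<..\<alpha>bar} \<and> p_divergent p \<alpha> \<and>
        euler_sequence F \<alpha> x \<and> x 0 \<in> tube \<delta> X
        \<longrightarrow> (\<forall>k. f (x k) \<le> L) \<and> (\<exists>k\<^sub>0. \<forall>k\<ge>k\<^sub>0. x k \<in> tube \<epsilon> zeros)"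
  proof (rule exI[of _ \<delta>], rule conjI[OF \<delta>(1)], rule exI[of _ a], rule conjI[OF la(3)],
      intro allI impI, elim conjE)
    fix \<alpha> x
    assume *: "range \<alpha> \<subseteq> {0<..a}" "p_divergent p \<alpha>" "euler_sequence F \<alpha> x" "x 0 \<in> tube \<delta> X"
    have "f (x 0) \<le> l / 2" "g (x 0) \<le> C" using \<delta>(2)[OF *(4)] by (auto simp: C_def)
    note trapped = trap[OF *(1,3) this]
    have "f (x k) \<le> L" for k using trapped la(2) order_trans by blast
    with trapped p_divergent_not_summable[OF *(2)]
    show "(\<forall>k. f (x k) \<le> L) \<and> (\<exists>k\<^sub>0. \<forall>k\<ge>k\<^sub>0. x k \<in> tube \<epsilon> zeros)" by blast
  qed
qed

text \<open>The start radius must not depend on the tube to be reached, whereas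
  \<open>attraction\<close> asks for \<open>f \<le> l / 2\<close> with \<open>l\<close> depending on
  it. One fixed trap below \<open>lbar / 2\<close> confines the sequence until \<open>f\<close> has
  fallen that far; the argument then restarts from there.\<close>

lemma asymptotically_p_d_stable_zeros: "asymptotically_p_d_stable F p zeros"
proof -
  have "0 < lbar / 2" using lbar by simp
  obtain l1 a1 where la1: "0 < l1" "l1 \<le> lbar / 2" "0 < a1"
    and trap1: "\<And>\<alpha> x. range \<alpha> \<subseteq> {0<..a1} \<Longrightarrow> euler_sequence F \<alpha> x \<Longrightarrow> f (x 0) \<le> l1 / 2 \<Longrightarrow> g (x 0) \<le> 1 \<Longrightarrow>
      (\<forall>k. f (x k) \<le> l1 \<and> g (x k) \<le> 1) \<and>
      (\<not> summable (\<lambda>k. \<alpha> k powr p) \<longrightarrow> (\<exists>k0. \<forall>k\<ge>k0. x k \<in> tube 1 zeros))"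
    by (rule attraction[OF zero_less_one zero_less_one \<open>0 < lbar / 2\<close>]) (rule that)
  have "0 < min (l1 / 2) 1" using la1 by simp
  then obtain \<delta> where \<delta>: "\<delta> > 0"
    "\<And>x. x \<in> tube \<delta> zeros \<Longrightarrow> f x \<le> min (l1 / 2) 1 \<and> g x \<le> min (l1 / 2) 1"
    using tube_zeros_values by blast
  have "(\<lambda>k. infdist (x k) zeros) \<longlonglongrightarrow> 0"
    if \<alpha>: "range \<alpha> \<subseteq> {0<..min a1 1}" "p_divergent p \<alpha>" "\<alpha> \<longlonglongrightarrow> 0"
      and euler: "euler_sequence F \<alpha> x" and x0: "x 0 \<in> tube \<delta> zeros" for \<alpha> x
  proof -
    have \<alpha>k: "0 < \<alpha> k" "\<alpha> k \<le> min a1 1" for k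
      using \<alpha>(1) by (meson greaterThanAtMost_iff range_subsetD)+
    have p_div: "\<not> summable (\<lambda>k. \<alpha> k powr p)" by (rule p_divergent_not_summable[OF \<alpha>(2)])
    then have div: "\<not> summable \<alpha>"
      using \<alpha>k p by (intro not_summable_if_powr_not_summable[of \<alpha> p]) auto
    have "range \<alpha> \<subseteq> {0<..a1}" using \<alpha>k by auto
    from trap1[OF this euler] \<delta>(2)[OF x0] have inv: "f (x k) \<le> l1" "g (x k) \<le> 1" for k
      by auto
    have "\<exists>k0. \<forall>k\<ge>k0. x k \<in> tube \<epsilon> zeros" if "\<epsilon> > 0" for \<epsilon>
    proof -
      obtain l a where la: "0 < l" "l \<le> 1" "0 < a"
        and trap: "\<And>\<alpha> x. range \<alpha> \<subseteq> {0<..a} \<Longrightarrow> euler_sequence F \<alpha> x \<Longrightarrow> f (x 0) \<le> l / 2 \<Longrightarrow> g (x 0) \<le> 1 \<Longrightarrow>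
          (\<forall>k. f (x k) \<le> l \<and> g (x k) \<le> 1) \<and>
          (\<not> summable (\<lambda>k. \<alpha> k powr p) \<longrightarrow> (\<exists>k0. \<forall>k\<ge>k0. x k \<in> tube \<epsilon> zeros))"
        by (rule attraction[OF \<open>\<epsilon> > 0\<close> zero_less_one zero_less_one]) (rule that)
      have "\<forall>\<^sub>F k in sequentially. \<alpha> k < a" using \<alpha>(3) la(3) by (rule order_tendstoD)
      then obtain k1 where k1: "\<And>k. k \<ge> k1 \<Longrightarrow> \<alpha> k < a" by (auto simp: eventually_sequentially)
      \<comment> \<open>The restart index is taken beyond \<open>k1\<close>, so that all later steps
        respect the bound \<open>a\<close> as well.\<close>
      have "\<exists>k\<ge>k1. f (x k) \<le> l / 2"
      proof (rule falls_below[OF compact_sublevel[of "l1 + 1"] _ _ noncritical euler \<alpha>(3) div])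
        show "x k \<in> {x. f x + g x \<le> l1 + 1}" for k
          using inv[of k] by simp
      qed (use la la1 lbar inv in auto)
      then obtain k where k: "k \<ge> k1" "f (x k) \<le> l / 2" by blast
      have "\<not> summable (\<lambda>i. \<alpha> (i + k) powr p)"
        using p_div by (simp add: summable_iff_shift[of "\<lambda>i. \<alpha> i powr p"])
      moreover have "range (\<lambda>i. \<alpha> (i + k)) \<subseteq> {0<..a}"
        using \<alpha>k(1) k1 k(1) by (auto simp: less_imp_le)
      moreover note trap[OF _ euler_shift[OF euler, of k]]
      ultimately obtain k0 where "\<And>i. i \<ge> k0 \<Longrightarrow> x (i + k) \<in> tube \<epsilon> zeros"
        using k(2) inv(2)[of k] by auto
      then have "x i \<in> tube \<epsilon> zeros" if "i \<ge> k0 + k" for i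
        using that by (metis add_leE le_add_diff_inverse2 add_le_imp_le_diff)
      then show ?thesis by blast
    qed
    then show ?thesis
      unfolding LIMSEQ_iff by (simp add: tube_def zeros_nonempty infdist_nonneg)
  qed
  then show ?thesis
    unfolding asymptotically_p_d_stable_def
    using d_stable_zeros \<delta>(1) la1(3)
    by (intro conjI exI[of _ \<delta>] exI[of _ "min a1 1"]) auto
qed

end

theorem theorem3p15:
  fixes F D :: "real ^ 'n \<Rightarrow> (real ^ 'n) set"
    and f g :: "real ^ 'n \<Rightarrow> real"
    and p :: real
  assumes F_usc: "upper_semicontinuous F"
    and F_values: "\<And>x. F x \<noteq> {} \<and> compact (F x)"
    and f_potential: "conservative_field f D"
    and descent: "\<And>xhat. \<exists>\<rho>>0. \<exists>\<kappa>\<in>pos_def_functions. \<forall>x\<in>ball xhat \<rho>.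
      (SUP u\<in>convex hull (F x). INF v\<in>D x. u \<bullet> v) \<le> - (INF w\<in>D x. \<kappa> w)"
    and no_critical_values: "\<exists>lbar>0. \<not> (\<exists>x. 0 \<in> D x \<and> f x \<in> {0<..<lbar})"
    and min_f: "has_minimum f 0"
    and p: "p \<in> {1..}"
    and g_continuous: "continuous_on UNIV g"
    and min_g: "has_minimum g 0"
    and g_Lyapunov: "\<And>x. x \<in> arg_min_set f \<inter> {x. g x > 0} \<Longrightarrow>
      \<exists>U. open U \<and> x \<in> U \<and> p_d_Lyapunov F p g U"
    and coercive: "coercive (\<lambda>x. f x + g x)"
  shows "asymptotic_p_attractor F f p (arg_min_set (\<lambda>x. f x + g x))"
proof -
  obtain lbar where lbar: "lbar > 0" "\<not> (\<exists>x. 0 \<in> D x \<and> f x \<in> {0<..<lbar})"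
    using no_critical_values by blast
  have f_min: "0 \<le> f x" "\<exists>x. f x = 0" for x
    using min_f by (auto simp: has_minimum_def arg_min_set_def is_arg_min_def not_less)
  have g_min: "0 \<le> g x" for x
    using min_g by (auto simp: has_minimum_def arg_min_set_def is_arg_min_def not_less)
  interpret euler_lyapunov F D f g p lbar
  proof
    show "\<exists>U. open U \<and> x \<in> U \<and> p_d_Lyapunov F p g U" if "f x = 0" "0 < g x" for x
    proof (rule g_Lyapunov)
      show "x \<in> arg_min_set f \<inter> {x. 0 < g x}"
        using that f_min(1) by (auto simp: arg_min_set_def is_arg_min_def not_less)
    qed
  qed (use F_usc F_values f_potential descent lbar f_min p g_continuous g_min coercive in auto)
  show ?thesis
    unfolding arg_min_set_eq_zeros asymptotic_p_attractor_def
    using p_attractor_zeros asymptotically_p_d_stable_zeros by blast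
qed

end
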